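(* Let $\mathfrak{g}=(\mathfrak{v},\mathfrak{e})$ be a diconnected and non-circular finite oriented graph. Let $Y\subset X_{\mathfrak{g}}$ be a clopen subset. Then there exist a rooted tree $\mathcal{T}=(\mathcal{V},\mathcal{E})$ with root $v_0$ and a colouring structure $\mathscr{C}$ on $\mathcal{T}$ such that the group $V_{\mathscr{C}}$ of colour-preserving almost automorphisms satisfies $$\mathcal{F}(\mathcal{G}_{\mathfrak{g}}|_Y)\cong V_{\mathscr{C}},$$ i.e. it is isomorphic to the topological full group of the reduction to $Y$ of the groupoid associated to the one-sided shift of $\mathfrak{g}$.
   Context: **Graphs and shifts.** A graph is a pair $\mathfrak{g}=(\mathfrak{v},\mathfrak{e})$ with maps $o,t\colon \mathfrak{e}\to\mathfrak{v}$ (origin, terminus); all graphs are oriented, and multiple edges and loops are allowed. The adjacency matrix $M_{\mathfrak{g}}$ has entries $M_{\mathfrak g}(v,w)=|\{e\in\mathfrak{e}\mid o(e)=v,\ t(e)=w\}|$. A finite graph is diconnected if for all $v,w\in\mathfrak{v}$ there is $n>0$ with $M_{\mathfrak{g}}^n(v,w)\neq 0$; it is non-circular if $M_{\mathfrak{g}}$ is not a permutation matrix. Let $X_{\mathfrak{g}}=\{(e_k)\in\mathfrak{e}^{\mathbb{N}}\mid \forall k\colon o(e_{k+1})=t(e_k)\}$, a closed subset of $\mathfrak{e}^{\mathbb N}$ (product topology), and $\sigma\colon X_{\mathfrak{g}}\to X_{\mathfrak{g}}$, $\sigma(e)_k=e_{k+1}$. **Groupoid.** The groupoid $\mathcal{G}_{\mathfrak{g}}$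 has object space $X_{\mathfrak{g}}$ and morphism space $\{(x,n-m,y)\in X_{\mathfrak g}\times\mathbb{Z}\times X_{\mathfrak g}\mid n,m\ge 0,\ \sigma^n(x)=\sigma^m(y)\}$, with topology generated by the sets $\{(x,n-m,y)\mid x\in U,\,y\in V,\,\sigma^n(x)=\sigma^m(y)\}$ for $U,V$ clopen and fixed $n,m$. Source $s$ is projection to the last factor, range $r$ projection to the first factor, and the product is $(x,a,y)(y,b,z)=(x,a+b,z)$. For clopen $Y\subset X_{\mathfrak{g}}$, $\mathcal{G}_{\mathfrak{g}}|_Y$ is the full subgroupoid with object set $Y$ (subspace topologies). A bisection of an étale groupoid $\mathcal{G}$ is a clopen set $U$ of morphisms such that $s|_U$ and $r|_U$ are homeomorphisms onto the object space $\mathcal{G}^{(0)}$. The topological full group is $\mathcal{F}(\mathcal{G})=\{r\circ(s|_U)^{-1}\in\operatorname{Homeo}(\mathcal{G}^{(0)})\mid U \text{ bisection}\}$. **Trees and almost automorphisms.** Let $\mathcal{T}=(\mathcal{V},\mathcal{E})$ be a locally finite tree with root $v_0$, edges oriented away from the root (so $t(e)$ is a child of $o(e)$). A finite subtree $T$ is complete if it contains $v_0$ and for each of its vertices contains all or none of its children. $\mathcal{L}T$ denotes the set of leaves (vertices without children in $T$), $\mathcal{T}_v$ the subtree of all descendants of $v$ (rooted at $v$), and $\mathcal{T}\setminus T:=\bigsqcup_{v\in\mathcal{L}T}\mathcal{T}_v$. An honest almost automorphism is a forest isomorphism $\varphi\colon\mathcal{T}\setminus T_1\to\mathcal{T}\setminus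 T_2$ with $T_1,T_2$ finite complete. Two of them, with domains $\mathcal{T}\setminus T_1$ and $\mathcal{T}\setminus T_1'$, are equivalent if they coincide on $\mathcal{T}\setminus T$ for some finite complete $T\supset T_1\cup T_1'$. The equivalence classes are the almost automorphisms; they form a group $\operatorname{AAut}(\mathcal{T})$ under composition of suitable representatives. **Colouring structures.** A colouring structure $\mathscr{C}=(L,\ell,\mathcal{D},\operatorname{ccol})$ on $\mathcal{T}$ consists of: a finite set $L$ of labels; a labelling $\ell\colon\mathcal{V}\setminus\{v_0\}\to L$ such that for $\ell(v)=\ell(w)$ there is a label-preserving bijection between the children of $v$ and the children of $w$, and such that for each $l\in L$ the set $\ell^{-1}(l)$ is not contained in any proper subtree of $\mathcal{T}$; a family $\mathcal{D}=\{D_{l,l'}\mid l,l'\in L\}$ of pairwise disjoint finite sets (colours), $|D_{l,l'}|$ being the number of children with label $l'$ of any vertex with label $l$; and a map $\operatorname{ccol}\colon\mathcal{E}\setminus o^{-1}(v_0)\to\bigsqcup_{l,l'}D_{l,l'}$ which for every $v\neq v_0$ with $\ell(v)=l$ and every $l'$ restricts to a bijection $\{e\in\mathcal{E}\mid o(e)=v,\ \ell(t(e))=l'\}\to D_{l,l'}$. $V_{\mathscr{C}}\le\operatorname{AAut}(\mathcal{T})$ is the group of almost automorphisms having a representative $\varphi\colon\mathcal{T}\setminus T_1\to\mathcal{T}\setminus T_2$ (with $T_1,T_2\neq\{v_0\}$) with $\operatorname{ccol}(\varphi(e))=\operatorname{ccol}(e)$ for every edge $e$ of $\mathcal{T}\setminus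 T_1$.
   Formalization: The clopen subset Y is assumed nonempty: for empty Y the topological full group has exactly one element, whereas V_C as defined never has exactly one element. *)

theory Defs
  imports
    "HOL-Analysis.Analysis"
    "HOL-Algebra.Bij"
    "HOL-Combinatorics.Permutations"
    "Graph_Theory.Graph_Theory"
begin

section \<open>Graphs and one-sided shifts\<close>

text \<open>
  An oriented graph is a \<open>pre_digraph\<close> (multiple arcs and loops allowed), with \<open>tail\<close> as
  the origin map and \<open>head\<close> as the terminus map.
\<close>

definition adj_matrix :: "('v, 'e) pre_digraph \<Rightarrow> 'v \<Rightarrow> 'v \<Rightarrow> nat" where
  "adj_matrix G v w = card {e \<in> arcs G. tail G e = v \<and> head G e = w}"

primrec adj_matrix_pow :: "('v, 'e) pre_digraph \<Rightarrow> nat \<Rightarrow> 'v \<Rightarrow> 'v \<Rightarrow> nat" where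
  "adj_matrix_pow G 0 = (\<lambda>v w. if v = w then 1 else 0)"
| "adj_matrix_pow G (Suc n) = (\<lambda>v w. \<Sum>u\<in>verts G. adj_matrix_pow G n v u * adj_matrix G u w)"

definition diconnected :: "('v, 'e) pre_digraph \<Rightarrow> bool" where
  "diconnected G \<longleftrightarrow> (\<forall>v\<in>verts G. \<forall>w\<in>verts G. \<exists>n>0. adj_matrix_pow G n v w \<noteq> 0)"

definition permutation_matrix :: "'v set \<Rightarrow> ('v \<Rightarrow> 'v \<Rightarrow> nat) \<Rightarrow> bool" where
  "permutation_matrix V M \<longleftrightarrow>
     (\<exists>p. p permutes V \<and> (\<forall>v\<in>V. \<forall>w\<in>V. M v w = (if w = p v then 1 else 0)))"

definition non_circular :: "('v, 'e) pre_digraph \<Rightarrow> bool" where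
  "non_circular G \<longleftrightarrow> \<not> permutation_matrix (verts G) (adj_matrix G)"

definition shift_space :: "('v, 'e) pre_digraph \<Rightarrow> (nat \<Rightarrow> 'e) set" where
  "shift_space G = {x. (\<forall>k. x k \<in> arcs G) \<and> (\<forall>k. tail G (x (Suc k)) = head G (x k))}"

definition shift_topology :: "('v, 'e) pre_digraph \<Rightarrow> (nat \<Rightarrow> 'e) topology" where
  "shift_topology G =
     subtopology (product_topology (\<lambda>k. discrete_topology (arcs G)) UNIV) (shift_space G)"

definition shift :: "(nat \<Rightarrow> 'e) \<Rightarrow> nat \<Rightarrow> 'e" where
  "shift x = (\<lambda>k. x (Suc k))"

definition clopenin :: "'a topology \<Rightarrow> 'a set \<Rightarrow> bool" where
  "clopenin X U \<longleftrightarrow> openin X U \<and> closedin X U"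


section \<open>Topological groupoids and topological full groups\<close>

text \<open>
  The object and morphism spaces are the carriers of the topologies. The product \<open>gmult g h\<close> is
  meaningful only if \<open>gsource g = grange h\<close>.
\<close>

record ('o, 'm) top_groupoid =
  gobj :: "'o topology"
  gmor :: "'m topology"
  gsource :: "'m \<Rightarrow> 'o"
  grange :: "'m \<Rightarrow> 'o"
  gmult :: "'m \<Rightarrow> 'm \<Rightarrow> 'm"

definition shift_groupoid_basic ::
  "('v, 'e) pre_digraph \<Rightarrow> nat \<Rightarrow> nat \<Rightarrow> (nat \<Rightarrow> 'e) set \<Rightarrow> (nat \<Rightarrow> 'e) set
     \<Rightarrow> ((nat \<Rightarrow> 'e) \<times> int \<times> (nat \<Rightarrow> 'e)) set" where
  "shift_groupoid_basic G n m U V =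
     {(x, int n - int m, y) | x y. x \<in> U \<and> y \<in> V \<and> (shift ^^ n) x = (shift ^^ m) y}"

text \<open>
  The carrier of the generated topology is the union of the generating sets, which is the whole
  morphism space, as seen by taking \<open>U\<close> and \<open>V\<close> to be the entire shift space.
\<close>

definition shift_groupoid ::
  "('v, 'e) pre_digraph \<Rightarrow> (nat \<Rightarrow> 'e, (nat \<Rightarrow> 'e) \<times> int \<times> (nat \<Rightarrow> 'e)) top_groupoid" where
  "shift_groupoid G = \<lparr>
     gobj = shift_topology G,
     gmor = topology_generated_by
       {shift_groupoid_basic G n m U V | n m U V.
          clopenin (shift_topology G) U \<and> clopenin (shift_topology G) V},
     gsource = (\<lambda>(x, a, y). y),
     grange = (\<lambda>(x, a, y). x),
     gmult = (\<lambda>(x, a, y) (y', b, z). (x, a + b, z)) \<rparr>"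

definition groupoid_restrict ::
  "('o, 'm) top_groupoid \<Rightarrow> 'o set \<Rightarrow> ('o, 'm) top_groupoid" where
  "groupoid_restrict \<G> Y = \<G>\<lparr>
     gobj := subtopology (gobj \<G>) Y,
     gmor := subtopology (gmor \<G>) {g. gsource \<G> g \<in> Y \<and> grange \<G> g \<in> Y} \<rparr>"

definition groupoid_bisection :: "('o, 'm) top_groupoid \<Rightarrow> 'm set \<Rightarrow> bool" where
  "groupoid_bisection \<G> U \<longleftrightarrow>
     clopenin (gmor \<G>) U \<and>
     homeomorphic_map (subtopology (gmor \<G>) U) (gobj \<G>) (gsource \<G>) \<and>
     homeomorphic_map (subtopology (gmor \<G>) U) (gobj \<G>) (grange \<G>)"

text \<open>
  As in \<open>BijGroup\<close>, self-homeomorphisms are represented by functions that are extensional on the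
  carrier of the space, and the multiplication is composition.
\<close>

definition homeo_group :: "'a topology \<Rightarrow> ('a \<Rightarrow> 'a) monoid" where
  "homeo_group X =
     (BijGroup (topspace X))\<lparr>carrier := {f \<in> Bij (topspace X). homeomorphic_map X X f}\<rparr>"

definition topological_full_group :: "('o, 'm) top_groupoid \<Rightarrow> ('o \<Rightarrow> 'o) monoid" where
  "topological_full_group \<G> = (homeo_group (gobj \<G>))\<lparr>carrier :=
     {f \<in> carrier (homeo_group (gobj \<G>)). \<exists>U. groupoid_bisection \<G> U \<and>
        f = (\<lambda>x\<in>topspace (gobj \<G>). grange \<G> (the_inv_into U (gsource \<G>) x))}\<rparr>"


section \<open>Rooted trees and almost automorphisms\<close>

text \<open>
  A rooted tree with its edges oriented away from the root is a graph in which every vertex is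
  reached from the root by exactly one directed walk.
\<close>

definition rooted_tree :: "('a, 'b) pre_digraph \<Rightarrow> 'a \<Rightarrow> bool" where
  "rooted_tree T r \<longleftrightarrow>
     wf_digraph T \<and> r \<in> verts T \<and> (\<forall>v\<in>verts T. \<exists>!p. pre_digraph.awalk T r p v)"

definition locally_finite_graph :: "('a, 'b) pre_digraph \<Rightarrow> bool" where
  "locally_finite_graph T \<longleftrightarrow> (\<forall>v\<in>verts T. finite (out_arcs T v) \<and> finite (in_arcs T v))"

definition children :: "('a, 'b) pre_digraph \<Rightarrow> 'a \<Rightarrow> 'a set" where
  "children T v = head T ` out_arcs T v"

text \<open>
  A subtree, i.e. a connected subgraph of the tree, contains every edge joining two of its
  vertices, so it is represented by its vertex set. Connectedness is that of the underlying
  unoriented graph, and includes being nonempty.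
\<close>

definition subtree :: "('a, 'b) pre_digraph \<Rightarrow> 'a set \<Rightarrow> bool" where
  "subtree T S \<longleftrightarrow> S \<subseteq> verts T \<and> Digraph_Component.connected (T \<restriction> S)"

definition complete_subtree :: "('a, 'b) pre_digraph \<Rightarrow> 'a \<Rightarrow> 'a set \<Rightarrow> bool" where
  "complete_subtree T r S \<longleftrightarrow>
     finite S \<and> subtree T S \<and> r \<in> S \<and> (\<forall>v\<in>S. children T v \<subseteq> S \<or> children T v \<inter> S = {})"

definition leaves :: "('a, 'b) pre_digraph \<Rightarrow> 'a set \<Rightarrow> 'a set" where
  "leaves T S = {v \<in> S. children T v \<inter> S = {}}"

definition descendants :: "('a, 'b) pre_digraph \<Rightarrow> 'a \<Rightarrow> 'a set" where
  "descendants T v = {w. v \<rightarrow>\<^sup>*\<^bsub>T\<^esub> w}"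

text \<open>
  The trees below distinct leaves are disjoint and no edge joins two of them, so their disjoint
  union is the subgraph induced on the union of their vertex sets.
\<close>

definition complement_forest ::
  "('a, 'b) pre_digraph \<Rightarrow> 'a set \<Rightarrow> ('a, 'b) pre_digraph" where
  "complement_forest T S = T \<restriction> (\<Union>v\<in>leaves T S. descendants T v)"

record ('a, 'b) tree_map =
  dom_tree :: "'a set"
  cod_tree :: "'a set"
  vmap :: "'a \<Rightarrow> 'a"
  emap :: "'b \<Rightarrow> 'b"

definition honest_almost_automorphism ::
  "('a, 'b) pre_digraph \<Rightarrow> 'a \<Rightarrow> ('a, 'b) tree_map \<Rightarrow> bool" where
  "honest_almost_automorphism T r \<phi> \<longleftrightarrow>
     complete_subtree T r (dom_tree \<phi>) \<and> complete_subtree T r (cod_tree \<phi>) \<and>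
     (let F = complement_forest T (dom_tree \<phi>); F' = complement_forest T (cod_tree \<phi>) in
        bij_betw (vmap \<phi>) (verts F) (verts F') \<and>
        bij_betw (emap \<phi>) (arcs F) (arcs F') \<and>
        (\<forall>e\<in>arcs F. tail F' (emap \<phi> e) = vmap \<phi> (tail F e) \<and>
                     head F' (emap \<phi> e) = vmap \<phi> (head F e)))"

definition almost_equal ::
  "('a, 'b) pre_digraph \<Rightarrow> 'a \<Rightarrow> (('a, 'b) tree_map \<times> ('a, 'b) tree_map) set" where
  "almost_equal T r = {(\<phi>, \<psi>).
     honest_almost_automorphism T r \<phi> \<and> honest_almost_automorphism T r \<psi> \<and>
     (\<exists>S. complete_subtree T r S \<and> dom_tree \<phi> \<union> dom_tree \<psi> \<subseteq> S \<and>
        (\<forall>v\<in>verts (complement_forest T S). vmap \<phi> v = vmap \<psi> v) \<and>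
        (\<forall>e\<in>arcs (complement_forest T S). emap \<phi> e = emap \<psi> e))}"

definition tree_map_id :: "'a \<Rightarrow> ('a, 'b) tree_map" where
  "tree_map_id r = \<lparr>dom_tree = {r}, cod_tree = {r}, vmap = id, emap = id\<rparr>"

definition tree_map_comp ::
  "('a, 'b) tree_map \<Rightarrow> ('a, 'b) tree_map \<Rightarrow> ('a, 'b) tree_map" where
  "tree_map_comp \<phi> \<psi> =
     \<lparr>dom_tree = dom_tree \<psi>, cod_tree = cod_tree \<phi>,
      vmap = vmap \<phi> \<circ> vmap \<psi>, emap = emap \<phi> \<circ> emap \<psi>\<rparr>"

text \<open>
  The product of two classes is the common class of all composites \<open>\<phi> \<circ> \<psi>\<close> of representatives
  for which the codomain of \<open>\<psi>\<close> is the domain of \<open>\<phi>\<close>.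
\<close>

definition AAut :: "('a, 'b) pre_digraph \<Rightarrow> 'a \<Rightarrow> ('a, 'b) tree_map set monoid" where
  "AAut T r = \<lparr>
     carrier = {\<phi>. honest_almost_automorphism T r \<phi>} // almost_equal T r,
     mult = (\<lambda>A B. \<Union>{almost_equal T r `` {tree_map_comp \<phi> \<psi>} | \<phi> \<psi>.
                        \<phi> \<in> A \<and> \<psi> \<in> B \<and> cod_tree \<psi> = dom_tree \<phi>}),
     one = almost_equal T r `` {tree_map_id r} \<rparr>"


section \<open>Colouring structures\<close>

record ('a, 'b, 'l, 'c) colouring =
  labels :: "'l set"
  lab :: "'a \<Rightarrow> 'l"
  colours :: "'l \<Rightarrow> 'l \<Rightarrow> 'c set"
  ccol :: "'b \<Rightarrow> 'c"

text \<open>The values of \<open>lab\<close> at the root and of \<open>ccol\<close> on edges issuing from the root are irrelevant.\<close>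

definition colouring_structure ::
  "('a, 'b) pre_digraph \<Rightarrow> 'a \<Rightarrow> ('a, 'b, 'l, 'c) colouring \<Rightarrow> bool" where
  "colouring_structure T r C \<longleftrightarrow>
     finite (labels C) \<and>
     lab C \<in> verts T - {r} \<rightarrow> labels C \<and>
     (\<forall>v\<in>verts T - {r}. \<forall>w\<in>verts T - {r}. lab C v = lab C w \<longrightarrow>
        (\<exists>f. bij_betw f (children T v) (children T w) \<and>
             (\<forall>u\<in>children T v. lab C (f u) = lab C u))) \<and>
     (\<forall>l\<in>labels C. \<nexists>S. subtree T S \<and> S \<noteq> verts T \<and> {v \<in> verts T - {r}. lab C v = l} \<subseteq> S) \<and>
     (\<forall>l\<in>labels C. \<forall>l'\<in>labels C. finite (colours C l l')) \<and>
     disjoint_family_on (\<lambda>(l, l'). colours C l l') (labels C \<times> labels C) \<and>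
     (\<forall>v\<in>verts T - {r}. \<forall>l'\<in>labels C.
        card (colours C (lab C v) l') = card {u \<in> children T v. lab C u = l'}) \<and>
     ccol C \<in> arcs T - out_arcs T r \<rightarrow> (\<Union>l\<in>labels C. \<Union>l'\<in>labels C. colours C l l') \<and>
     (\<forall>v\<in>verts T - {r}. \<forall>l'\<in>labels C.
        bij_betw (ccol C) {e \<in> out_arcs T v. lab C (head T e) = l'} (colours C (lab C v) l'))"

definition colour_preserving_group ::
  "('a, 'b) pre_digraph \<Rightarrow> 'a \<Rightarrow> ('a, 'b, 'l, 'c) colouring \<Rightarrow> ('a, 'b) tree_map set monoid" where
  "colour_preserving_group T r C = (AAut T r)\<lparr>carrier :=
     {A \<in> carrier (AAut T r). \<exists>\<phi>\<in>A. dom_tree \<phi> \<noteq> {r} \<and> cod_tree \<phi> \<noteq> {r} \<and>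
        (\<forall>e\<in>arcs (complement_forest T (dom_tree \<phi>)). ccol C (emap \<phi> e) = ccol C e)}\<rparr>"

end

theory Submission
  imports Defs "HOL-Library.Omega_Words_Fun"
begin

text \<open>
  Let \<open>Y\<close> be a union of cylinders over words of length \<open>N\<close>. The tree has an empty root, its other
  vertices are the finite prefixes of length at least \<open>N\<close> of the points of \<open>Y\<close>, and the children of
  a word are its one-letter continuations. The label of a word is the graph vertex at which it ends,
  and the colour of an arc is the letter that it appends. The space of ends of this tree is \<open>Y\<close>.

  Both groups are the group of \<^emph>\<open>prefix exchanges\<close>: bijections of \<open>Y\<close> that on each of finitely many
  cylinders replace the prefix \<open>v\<close> by another prefix \<open>v'\<close> and keep the tail.

  On the groupoid side, a homeomorphism from the full group satisfies, near each point \<open>x\<close>, an identity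
  \<open>\<sigma>\<^sup>n (f y) = \<sigma>\<^sup>m y\<close> with fixed \<open>n\<close> and \<open>m\<close>, so with continuity it exchanges a fixed prefix near \<open>x\<close>;
  compactness of \<open>Y\<close> makes the length of the replaced prefix uniform
  (\<open>full_group_exchanges_prefixes\<close>). Conversely the morphisms \<open>(f y, |v'| - |v|, y)\<close> form a bisection
  (\<open>exchanges_prefixes_full_group\<close>).

  On the tree side, an isomorphism of forests that preserves colours appends the same letters to the
  image of a leaf as to the leaf itself, so it sends \<open>v u\<close> to \<open>v' u\<close> and acts on the ends by a prefix
  exchange (\<open>colour_preserving_induces_exchange\<close>). Conversely the cylinders on which a prefix
  exchange is of the form \<open>v z \<mapsto> v' z\<close> can be taken to be the leaves of a complete subtree, and their
  images are again the leaves of one (\<open>exchange_induced_by_colour_preserving\<close>).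

  The isomorphism \<open>induced_class\<close> sends \<open>f\<close> to the set of all honest almost automorphisms that map
  the long prefixes of each \<open>x\<close> to prefixes of \<open>f x\<close> and keep the tails. That this set is a single
  class rests on
  \<open>prefixing_determines_word\<close>: as no infinite path of a diconnected non-circular graph is
  isolated, a word is determined by what it prefixes to the paths from a vertex. Products are
  matched by choosing representatives in which the codomain of one is the domain of the other
  (\<open>induced_class_mult\<close>).
\<close>

section \<open>One-sided paths in a diconnected, non-circular graph\<close>

lemma shift_spaceI:
  assumes "\<And>k. x k \<in> arcs G" "\<And>k. tail G (x (Suc k)) = head G (x k)"
  shows "x \<in> shift_space G"
  using assms by (simp add: shift_space_def)

lemma suffix_in_shift_space: "x \<in> shift_space G \<Longrightarrow> suffix n x \<in> shift_space G"
  by (simp add: shift_space_def)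

lemma funpow_shift: "(shift ^^ n) x = suffix n x"
  by (induction n) (simp_all add: shift_def fun_eq_iff)

lemma prefix_conc_in_shift_space:
  assumes x: "x \<in> shift_space G" and z: "z \<in> shift_space G" and "0 < n"
    and start: "tail G (z 0) = head G (x (n - 1))"
  shows "prefix n x \<frown> z \<in> shift_space G"
proof (rule shift_spaceI)
  fix k
  show "(prefix n x \<frown> z) k \<in> arcs G"
    using x z by (cases "k < n") (auto simp: shift_space_def)
  consider "Suc k < n" | "Suc k = n" | "n \<le> k" by linarith
  then show "tail G ((prefix n x \<frown> z) (Suc k)) = head G ((prefix n x \<frown> z) k)"
  proof cases
    case 1
    then show ?thesis using x by (simp add: shift_space_def)
  next
    case 2
    then show ?thesis using start by auto
  next
    case 3
    then show ?thesis using z by (simp add: shift_space_def Suc_diff_le)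
  qed
qed

lemma (in wf_digraph) walk_conc_in_shift_space:
  assumes "awalk u p v" "z \<in> shift_space G" "tail G (z 0) = v"
  shows "p \<frown> z \<in> shift_space G \<and> tail G ((p \<frown> z) 0) = u"
  using assms(1)
proof (induction p arbitrary: u)
  case Nil
  then show ?case using assms by (simp add: awalk_Nil_iff)
next
  case (Cons e p)
  then have e: "e \<in> arcs G" "tail G e = u" and p: "awalk (head G e) p v"
    by (simp_all add: awalk_Cons_iff)
  from Cons.IH[OF p] have IH: "p \<frown> z \<in> shift_space G" "tail G ((p \<frown> z) 0) = head G e" by auto
  have "(e ## p \<frown> z) k \<in> arcs G \<and>
      tail G ((e ## p \<frown> z) (Suc k)) = head G ((e ## p \<frown> z) k)" for k
    using IH e by (cases k) (auto simp: shift_space_def)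
  then show ?case using e by (auto intro: shift_spaceI)
qed

lemma prefix_le_eq:
  assumes "prefix n x = prefix n y" "m \<le> n"
  shows "prefix m x = prefix m y"
  by (metis assms min.absorb2 min.commute subsequence_take add_0)

lemma prefix_eq_iff: "prefix n x = prefix n y \<longleftrightarrow> (\<forall>i<n. x i = y i)"
  by (auto simp: list_eq_iff_nth_eq)

lemma prefix_add: "prefix (m + n) x = prefix m x @ prefix n (suffix m x)"
  by (simp add: subsequence_append)

text \<open>For nonempty \<open>t\<close>, a solution of \<open>z = t \<frown> z\<close> must be the periodic word \<open>t t t \<dots>\<close>.\<close>

lemma prefixing_fixes_one_word:
  assumes "z = t \<frown> z" "z' = t \<frown> z'" "t \<noteq> []"
  shows "z = z'"
proof
  fix i
  show "z i = z' i"
  proof (induction i rule: less_induct)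
    case (less i)
    show ?case
    proof (cases "i < length t")
      case True
      then show ?thesis using assms by (metis conc_fst)
    next
      case False
      then have "z i = z (i - length t)" "z' i = z' (i - length t)"
        using assms(1,2) by (metis conc_snd)+
      moreover have "z (i - length t) = z' (i - length t)"
        using False assms(3) by (intro less.IH) (cases t, auto simp: not_less)
      ultimately show ?thesis by simp
    qed
  qed
qed

lemma conc_eq_cases:
  assumes "a \<frown> x = b \<frown> y" "length a \<le> length b"
  obtains t where "b = a @ t" "x = t \<frown> y"
proof -
  have "prefix (length a) (a \<frown> x) = prefix (length a) (b \<frown> y)" using assms by simp
  then have "a = take (length a) b" using assms(2) by simp
  then have b: "b = a @ drop (length a) b" by (metis append_take_drop_id)
  have "a \<frown> x = a \<frown> drop (length a) b \<frown> y"
    by (metis assms(1) b conc_conc)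
  then have "x = drop (length a) b \<frown> y" by (simp only: same_concat_eq)
  with b that show ?thesis by blast
qed

text \<open>
  Diconnectedness makes every vertex reachable from every other one by a nonempty walk, and
  non-circularity adds a branching; together they exclude isolated infinite paths.
\<close>

locale branching_graph = fin_digraph G for G :: "('v, 'e) pre_digraph" +
  assumes diconnected: "diconnected G"
    and non_circular: "non_circular G"
begin

lemma adj_matrix_pow_walk:
  "v \<in> verts G \<Longrightarrow> adj_matrix_pow G n v w \<noteq> 0 \<Longrightarrow> \<exists>p. length p = n \<and> awalk v p w"
proof (induction n arbitrary: w)
  case 0
  then show ?case by (auto simp: awalk_Nil_iff split: if_splits)
next
  case (Suc n)
  then obtain u where u: "u \<in> verts G" "adj_matrix_pow G n v u \<noteq> 0" "adj_matrix G u w \<noteq> 0"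
    by (auto dest: sum.not_neutral_contains_not_neutral)
  then obtain e where e: "e \<in> arcs G" "tail G e = u" "head G e = w"
    by (auto simp: adj_matrix_def card_eq_0_iff)
  from Suc.IH Suc.prems u obtain p where p: "length p = n" "awalk v p u" by blast
  with e have "awalk v (p @ [e]) w"
    by (auto simp: awalk_append_iff awalk_Cons_iff awalk_Nil_iff)
  with p show ?case by (intro exI[of _ "p @ [e]"]) auto
qed

lemma diconnected_walk:
  assumes "v \<in> verts G" "w \<in> verts G"
  obtains p where "p \<noteq> []" "awalk v p w"
proof -
  from diconnected assms obtain n where "n > 0" "adj_matrix_pow G n v w \<noteq> 0"
    by (auto simp: diconnected_def)
  with adj_matrix_pow_walk[OF assms(1), of n w] obtain p where "length p = n" "awalk v p w"
    by blast
  with \<open>n > 0\<close> show ?thesis by (intro that[of p]) auto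
qed

lemma out_arc_exists:
  assumes "v \<in> verts G"
  shows "\<exists>e\<in>arcs G. tail G e = v"
proof -
  obtain p where p: "p \<noteq> []" "awalk v p v" using diconnected_walk[OF assms assms] .
  then show ?thesis by (cases p) (auto simp: awalk_Cons_iff)
qed

lemma in_arc_exists:
  assumes "v \<in> verts G"
  shows "\<exists>e\<in>arcs G. head G e = v"
proof -
  obtain p where p: "p \<noteq> []" "awalk v p v" using diconnected_walk[OF assms assms] .
  then have "last p \<in> arcs G \<and> head G (last p) = v"
    by (metis awalk_Cons_iff awalk_Nil_iff awalk_append_iff append_butlast_last_id)
  then show ?thesis by blast
qed

text \<open>
  If every vertex emitted a single arc, following it would be a surjective, hence bijective, map of
  the finite vertex set, and the adjacency matrix would be its permutation matrix.
\<close>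

lemma branching_vertex: "\<exists>a\<in>arcs G. \<exists>b\<in>arcs G. a \<noteq> b \<and> tail G a = tail G b"
proof (rule ccontr)
  assume "\<not> ?thesis"
  then have uniq: "a = b" if "a \<in> arcs G" "b \<in> arcs G" "tail G a = tail G b" for a b
    using that by blast
  obtain out where out: "\<And>v. v \<in> verts G \<Longrightarrow> out v \<in> arcs G \<and> tail G (out v) = v"
    using out_arc_exists by metis
  define p where "p v = (if v \<in> verts G then head G (out v) else v)" for v
  have "p ` verts G = verts G"
  proof (intro subset_antisym subsetI)
    fix w assume "w \<in> verts G"
    then obtain e where e: "e \<in> arcs G" "head G e = w" using in_arc_exists by blast
    then have "out (tail G e) = e" using e out[of "tail G e"] by (intro uniq) auto
    with e show "w \<in> p ` verts G" by (auto simp: p_def intro!: image_eqI[of _ _ "tail G e"])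
  qed (auto simp: p_def out)
  then have "bij_betw p (verts G) (verts G)"
    by (simp add: bij_betw_def finite_surj_inj)
  then have "p permutes verts G"
    by (rule bij_imp_permutes) (simp add: p_def)
  moreover have "adj_matrix G v w = (if w = p v then 1 else 0)" if v: "v \<in> verts G" for v w
  proof -
    have "e = out v" if "e \<in> arcs G" "tail G e = v" for e
      using that out[OF v] by (intro uniq) auto
    then have "{e \<in> arcs G. tail G e = v \<and> head G e = w} = (if w = p v then {out v} else {})"
      using v out[OF v] by (auto simp: p_def)
    then show ?thesis by (simp add: adj_matrix_def)
  qed
  ultimately show False
    using non_circular unfolding non_circular_def permutation_matrix_def by blast
qed

lemma path_from_vertex:
  assumes "v \<in> verts G"
  shows "\<exists>z\<in>shift_space G. tail G (z 0) = v"
proof -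
  obtain out where out: "\<And>v. v \<in> verts G \<Longrightarrow> out v \<in> arcs G \<and> tail G (out v) = v"
    using out_arc_exists by metis
  define z where "z = rec_nat (out v) (\<lambda>_ e. out (head G e))"
  have z: "z 0 = out v" "z (Suc k) = out (head G (z k))" for k
    by (simp_all add: z_def)
  have "z k \<in> arcs G" for k
    by (induction k) (auto simp: z out assms)
  then have "z \<in> shift_space G" by (intro shift_spaceI) (auto simp: z out)
  moreover have "tail G (z 0) = v" using assms by (simp add: z out)
  ultimately show ?thesis by blast
qed

text \<open>Walk to a branching vertex and leave it along two different arcs.\<close>

lemma two_paths_from_vertex:
  assumes "v \<in> verts G"
  shows "\<exists>z\<in>shift_space G. \<exists>z'\<in>shift_space G. z \<noteq> z' \<and> tail G (z 0) = v \<and> tail G (z' 0) = v"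
proof -
  obtain a b where ab: "a \<in> arcs G" "b \<in> arcs G" "a \<noteq> b" "tail G a = tail G b"
    using branching_vertex by blast
  obtain p where p: "awalk v p (tail G a)"
    using diconnected_walk[OF assms tail_in_verts[OF ab(1)]] .
  have ext: "\<exists>z\<in>shift_space G. tail G (z 0) = v \<and> z (length p) = e"
    if e: "e \<in> arcs G" "tail G e = tail G a" for e
  proof -
    obtain z where z: "z \<in> shift_space G" "tail G (z 0) = head G e"
      using path_from_vertex[of "head G e"] e by auto
    have "awalk v (p @ [e]) (head G e)"
      using p e by (auto simp: awalk_append_iff awalk_Cons_iff awalk_Nil_iff)
    then have "(p @ [e]) \<frown> z \<in> shift_space G \<and> tail G (((p @ [e]) \<frown> z) 0) = v"
      using walk_conc_in_shift_space z by blast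
    moreover have "((p @ [e]) \<frown> z) (length p) = e" by (simp add: conc_def)
    ultimately show ?thesis by blast
  qed
  obtain z where z: "z \<in> shift_space G" "tail G (z 0) = v" "z (length p) = a"
    using ext[OF ab(1)] by blast
  obtain z' where z': "z' \<in> shift_space G" "tail G (z' 0) = v" "z' (length p) = b"
    using ext[OF ab(2) ab(4)[symmetric]] by blast
  from z z' ab(3) have "z \<noteq> z'" by auto
  with z z' show ?thesis by blast
qed

text \<open>
  If \<open>a\<close> and \<open>b\<close> prefix all paths from \<open>v\<close> in the same way and \<open>b = a @ t\<close>, then every path from \<open>v\<close>
  is fixed by prefixing \<open>t\<close>. For nonempty \<open>t\<close> this leaves only one path, but there are two.
\<close>

lemma prefixing_determines_word:
  assumes v: "v \<in> verts G"
    and eq: "\<And>z. z \<in> shift_space G \<Longrightarrow> tail G (z 0) = v \<Longrightarrow> a \<frown> z = b \<frown> z"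
  shows "a = b"
proof -
  have wlog: "a = b"
    if le: "length a \<le> length b"
      and eq: "\<And>z. z \<in> shift_space G \<Longrightarrow> tail G (z 0) = v \<Longrightarrow> a \<frown> z = b \<frown> z" for a b :: "'e list"
  proof (rule ccontr)
    assume "a \<noteq> b"
    obtain z z' where z: "z \<in> shift_space G" "z' \<in> shift_space G" "z \<noteq> z'"
        "tail G (z 0) = v" "tail G (z' 0) = v"
      using two_paths_from_vertex[OF v] by blast
    obtain t where t: "b = a @ t" "z = t \<frown> z"
      using conc_eq_cases[OF eq[OF z(1,4)] le] .
    have "a \<frown> z' = a \<frown> t \<frown> z'" using eq[OF z(2,5)] unfolding t(1) conc_conc .
    then have "z' = t \<frown> z'" by (simp only: same_concat_eq)
    moreover have "t \<noteq> []" using t(1) \<open>a \<noteq> b\<close> by auto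
    ultimately have "z = z'" by (rule prefixing_fixes_one_word[OF t(2)])
    with z show False by simp
  qed
  show ?thesis
  proof (cases "length a \<le> length b")
    case True
    then show ?thesis using wlog eq by blast
  next
    case False
    then show ?thesis using wlog[of b a] eq by force
  qed
qed

end

section \<open>The topology of the shift space\<close>

lemma topspace_shift_topology: "topspace (shift_topology G) = shift_space G"
  by (auto simp: shift_topology_def shift_space_def)

lemma openin_cylinder:
  assumes "w \<in> shift_space G"
  shows "openin (shift_topology G) {y \<in> shift_space G. prefix n y = prefix n w}"
proof -
  let ?B = "\<lambda>k. if k < n then {w k} else arcs G"
  have "openin (product_topology (\<lambda>k. discrete_topology (arcs G)) UNIV) (PiE UNIV ?B)"
    using assms by (intro product_topology_basis) (auto simp: shift_space_def)
  moreover have "{y \<in> shift_space G. prefix n y = prefix n w} = PiE UNIV ?B \<inter> shift_space G"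
    by (auto simp: prefix_eq_iff shift_space_def PiE_def Pi_def split: if_splits)
  ultimately show ?thesis
    unfolding shift_topology_def openin_subtopology by blast
qed

lemma openin_shift_topology:
  "openin (shift_topology G) U \<longleftrightarrow>
     U \<subseteq> shift_space G \<and> (\<forall>x\<in>U. \<exists>n. \<forall>y\<in>shift_space G. prefix n y = prefix n x \<longrightarrow> y \<in> U)"
    (is "_ \<longleftrightarrow> ?R")
proof
  assume U: "openin (shift_topology G) U"
  then obtain U' where U': "openin (product_topology (\<lambda>k. discrete_topology (arcs G)) UNIV) U'"
      and UU': "U = U' \<inter> shift_space G"
    unfolding shift_topology_def openin_subtopology by blast
  have "\<exists>n. \<forall>y\<in>shift_space G. prefix n y = prefix n x \<longrightarrow> y \<in> U" if x: "x \<in> U" for x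
  proof -
    from x UU' have "x \<in> U'" by blast
    from bspec[OF iffD1[OF openin_product_topology_alt U'] this]
    obtain B where B: "x \<in> PiE UNIV B" "finite {i. B i \<noteq> arcs G}" "PiE UNIV B \<subseteq> U'"
      by auto
    obtain n where n: "\<And>i. B i \<noteq> arcs G \<Longrightarrow> i < n"
      using B(2) unfolding finite_nat_set_iff_bounded by blast
    have "y \<in> U" if y: "y \<in> shift_space G" "prefix n y = prefix n x" for y
    proof -
      have "y i \<in> B i" for i
        using n[of i] y B(1) by (cases "i < n") (auto simp: prefix_eq_iff shift_space_def)
      with B(3) y UU' show ?thesis by auto
    qed
    then show ?thesis by blast
  qed
  with U show ?R using openin_subset[OF U] by (auto simp: topspace_shift_topology)
next
  assume R: ?R
  show "openin (shift_topology G) U"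
  proof (subst openin_subopen, intro ballI)
    fix x assume x: "x \<in> U"
    with R obtain n where "\<forall>y\<in>shift_space G. prefix n y = prefix n x \<longrightarrow> y \<in> U" by blast
    with x R show "\<exists>T. openin (shift_topology G) T \<and> x \<in> T \<and> T \<subseteq> U"
      by (intro exI[of _ "{y \<in> shift_space G. prefix n y = prefix n x}"])
        (auto intro!: openin_cylinder)
  qed
qed

lemma clopenin_cylinder:
  assumes "w \<in> shift_space G"
  shows "clopenin (shift_topology G) {y \<in> shift_space G. prefix n y = prefix n w}"
proof -
  have "openin (shift_topology G) (shift_space G - {y \<in> shift_space G. prefix n y = prefix n w})"
    unfolding openin_shift_topology by (auto intro!: exI[of _ n])
  then show ?thesis
    using openin_cylinder[OF assms] by (auto simp: clopenin_def closedin_def topspace_shift_topology)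
qed

text \<open>
  The finite alphabet gives a compact product, in which a violated composability condition
  \<open>tail (x (k + 1)) \<noteq> head (x k)\<close> is visible from finitely many letters.
\<close>

lemma (in fin_digraph) compact_space_shift_topology: "compact_space (shift_topology G)"
proof -
  let ?P = "product_topology (\<lambda>k::nat. discrete_topology (arcs G)) UNIV"
  have cs: "compact_space ?P"
    by (simp add: compact_space_product_topology compact_space_discrete_topology)
  have "openin ?P (topspace ?P - shift_space G)"
  proof (subst openin_subopen, intro ballI)
    fix x assume x: "x \<in> topspace ?P - shift_space G"
    then obtain k where k: "tail G (x (Suc k)) \<noteq> head G (x k)"
      by (auto simp: shift_space_def)
    let ?B = "\<lambda>i. if i \<le> Suc k then {x i} else arcs G"
    have "openin ?P (PiE UNIV ?B)"
      using x by (intro product_topology_basis) (auto simp: PiE_def Pi_def)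
    moreover have "x \<in> PiE UNIV ?B" using x by (auto simp: PiE_def Pi_def)
    moreover have "PiE UNIV ?B \<subseteq> topspace ?P - shift_space G"
    proof
      fix y assume y: "y \<in> PiE UNIV ?B"
      have "y i \<in> arcs G" for i using PiE_mem[OF y, of i] x by (auto split: if_splits)
      moreover have "y (Suc k) = x (Suc k)" "y k = x k"
        using PiE_mem[OF y, of "Suc k"] PiE_mem[OF y, of k] by auto
      ultimately show "y \<in> topspace ?P - shift_space G"
        using k by (auto simp: shift_space_def intro!: exI[of _ k])
    qed
    ultimately show "\<exists>T. openin ?P T \<and> x \<in> T \<and> T \<subseteq> topspace ?P - shift_space G" by blast
  qed
  moreover have "shift_space G \<subseteq> topspace ?P" by (auto simp: shift_space_def)
  ultimately have "closedin ?P (shift_space G)" by (simp add: closedin_def)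
  then show ?thesis
    unfolding shift_topology_def by (simp add: closedin_compact_space cs compact_space_subtopology)
qed

text \<open>
  Compactness makes a choice of cylinders uniform: finitely many of the cylinders around the points
  of \<open>Y\<close> cover it, and the longest of their words works everywhere.
\<close>

lemma (in fin_digraph) uniform_prefix_length:
  assumes Y: "closedin (shift_topology G) Y"
    and ex: "\<And>x. x \<in> Y \<Longrightarrow> \<exists>n. Q (prefix n x)"
    and mono: "\<And>w u. Q w \<Longrightarrow> Q (w @ u)"
  obtains n where "\<And>x m. x \<in> Y \<Longrightarrow> n \<le> m \<Longrightarrow> Q (prefix m x)"
proof -
  obtain l where l: "\<And>x. x \<in> Y \<Longrightarrow> Q (prefix (l x) x)" using ex by metis
  let ?C = "\<lambda>x. {y \<in> shift_space G. prefix (l x) y = prefix (l x) x}"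
  have YX: "Y \<subseteq> shift_space G" using closedin_subset[OF Y] by (simp add: topspace_shift_topology)
  have "compactin (shift_topology G) Y"
    using Y compact_space_shift_topology by (simp add: closedin_compact_space)
  then have "\<exists>\<F>. finite \<F> \<and> \<F> \<subseteq> ?C ` Y \<and> Y \<subseteq> \<Union>\<F>"
    by (rule compactinD) (use YX in \<open>auto intro: openin_cylinder\<close>)
  then obtain \<F> where "finite \<F>" "\<F> \<subseteq> ?C ` Y" "Y \<subseteq> \<Union>\<F>"
    by (elim exE conjE)
  then obtain F where F: "finite F" "F \<subseteq> Y" "Y \<subseteq> \<Union>(?C ` F)"
    using finite_subset_image[of \<F> ?C Y] by blast
  show ?thesis
  proof
    fix x m assume x: "x \<in> Y" and m: "Max (l ` F) \<le> m"
    then obtain y where y: "y \<in> F" "prefix (l y) x = prefix (l y) y" using F by auto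
    have "l y \<le> Max (l ` F)" using y(1) F(1) by simp
    then obtain j where "m = l y + j" using m le_Suc_ex le_trans by blast
    then have "prefix m x = prefix (l y) y @ prefix j (suffix (l y) x)"
      using prefix_add[of x "l y" j] y(2) by simp
    moreover have "Q (prefix (l y) y)" using l y F by blast
    ultimately show "Q (prefix m x)" using mono by metis
  qed
qed

section \<open>The topological full group as a group of prefix exchanges\<close>

text \<open>
  One length \<open>K\<close> of replaced prefixes suffices for all points, as a longer prefix may be replaced
  together with its continuation. The bound \<open>N\<close> on the new prefixes makes them vertices of the tree
  below.
\<close>

definition exchanges_prefixes ::
  "(nat \<Rightarrow> 'e) set \<Rightarrow> nat \<Rightarrow> ((nat \<Rightarrow> 'e) \<Rightarrow> nat \<Rightarrow> 'e) \<Rightarrow> nat \<Rightarrow> ('e list \<Rightarrow> 'e list) \<Rightarrow> bool" where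
  "exchanges_prefixes Y N f K \<beta> \<longleftrightarrow>
     (\<forall>x\<in>Y. N \<le> length (\<beta> (prefix K x)) \<and> f x = \<beta> (prefix K x) \<frown> suffix K x)"

text \<open>
  New prefixes may be shorter than \<open>K\<close>, in which case \<open>l\<close> letters of \<open>f x\<close> depend on up to \<open>K + l\<close>
  letters of \<open>x\<close>.
\<close>

lemma exchanges_prefixes_local:
  assumes ex: "exchanges_prefixes Y N f K \<beta>" and "x \<in> Y" "y \<in> Y"
    and eq: "prefix (K + l) x = prefix (K + l) y"
  shows "prefix l (f x) = prefix l (f y)"
proof -
  have xy: "x i = y i" if "i < K + l" for i using eq that by (simp add: prefix_eq_iff)
  then have K: "prefix K x = prefix K y" by (simp add: prefix_eq_iff)
  have "f x i = f y i" if "i < l" for i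
    using assms(2,3) ex K that xy[of "K + (i - length (\<beta> (prefix K y)))"]
    by (cases "i < length (\<beta> (prefix K y))") (auto simp: exchanges_prefixes_def)
  then show ?thesis by (simp add: prefix_eq_iff)
qed

lemma openin_shift_topologyD:
  assumes "openin (shift_topology G) U" "x \<in> U"
  shows "\<exists>n. \<forall>y\<in>shift_space G. prefix n y = prefix n x \<longrightarrow> y \<in> U"
  using assms unfolding openin_shift_topology by (elim conjE bspec)

locale clopen_subshift = fin_digraph G for G :: "('v, 'e) pre_digraph" +
  fixes Y :: "(nat \<Rightarrow> 'e) set"
  assumes clopen: "clopenin (shift_topology G) Y"
begin

abbreviation Y_top :: "(nat \<Rightarrow> 'e) topology" where
  "Y_top \<equiv> subtopology (shift_topology G) Y"

abbreviation Y_groupoid :: "(nat \<Rightarrow> 'e, (nat \<Rightarrow> 'e) \<times> int \<times> (nat \<Rightarrow> 'e)) top_groupoid" where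
  "Y_groupoid \<equiv> groupoid_restrict (shift_groupoid G) Y"

lemma Y_subset: "Y \<subseteq> shift_space G"
  using clopen openin_subset[of "shift_topology G" Y]
  by (simp add: clopenin_def topspace_shift_topology)

lemma topspace_Y_top: "topspace Y_top = Y"
  using Y_subset by (auto simp: topspace_shift_topology)

lemma openin_Y_top:
  "openin Y_top U \<longleftrightarrow> U \<subseteq> Y \<and> (\<forall>x\<in>U. \<exists>n. \<forall>y\<in>Y. prefix n y = prefix n x \<longrightarrow> y \<in> U)"
  (is "_ \<longleftrightarrow> ?R")
proof
  assume "openin Y_top U"
  then have U: "openin (shift_topology G) U" "U \<subseteq> Y"
    using clopen by (simp_all add: openin_open_subtopology clopenin_def)
  then show ?R unfolding openin_shift_topology using Y_subset by blast
next
  assume R: ?R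
  have "\<exists>n. \<forall>y\<in>shift_space G. prefix n y = prefix n x \<longrightarrow> y \<in> U" if x: "x \<in> U" for x
  proof -
    obtain n where n: "\<And>y. y \<in> Y \<Longrightarrow> prefix n y = prefix n x \<Longrightarrow> y \<in> U"
      using R x by blast
    have "x \<in> Y" using R x by blast
    then have "\<exists>m. \<forall>y\<in>shift_space G. prefix m y = prefix m x \<longrightarrow> y \<in> Y"
      using openin_shift_topologyD[of G Y x] clopen by (simp add: clopenin_def)
    then obtain m where m: "\<And>y. y \<in> shift_space G \<Longrightarrow> prefix m y = prefix m x \<Longrightarrow> y \<in> Y"
      by blast
    have "y \<in> U" if "y \<in> shift_space G" "prefix (max m n) y = prefix (max m n) x" for y
      using that prefix_le_eq[of y "max m n" x m] prefix_le_eq[of y "max m n" x n] m n by simp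
    then show ?thesis by blast
  qed
  then show "openin Y_top U"
    using R Y_subset clopen
    by (auto simp: openin_open_subtopology clopenin_def openin_shift_topology)
qed

lemma openin_Y_topD:
  assumes "openin Y_top U" "x \<in> U"
  shows "\<exists>n. \<forall>y\<in>Y. prefix n y = prefix n x \<longrightarrow> y \<in> U"
  using assms unfolding openin_Y_top by (elim conjE bspec)

lemma gobj_Y_groupoid: "gobj Y_groupoid = Y_top"
  and gsource_Y_groupoid: "gsource Y_groupoid = (\<lambda>(x, a, y). y)"
  and grange_Y_groupoid: "grange Y_groupoid = (\<lambda>(x, a, y). x)"
  by (simp_all add: groupoid_restrict_def shift_groupoid_def)

lemma gsource_shift_groupoid: "gsource (shift_groupoid G) = (\<lambda>(x, a, y). y)"
  and grange_shift_groupoid: "grange (shift_groupoid G) = (\<lambda>(x, a, y). x)"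
  by (simp_all add: shift_groupoid_def)

lemma topspace_gmor:
  "topspace (gmor Y_groupoid) =
     {(x, int n - int m, y) | x y n m. x \<in> Y \<and> y \<in> Y \<and> suffix n x = suffix m y}"
  (is "_ = ?M")
proof -
  let ?S = "{shift_groupoid_basic G n m U V | n m U V.
     clopenin (shift_topology G) U \<and> clopenin (shift_topology G) V}"
  have "topspace (gmor Y_groupoid) = \<Union>?S \<inter> {(x, a, y). y \<in> Y \<and> x \<in> Y}"
    unfolding groupoid_restrict_def by (simp add: shift_groupoid_def case_prod_beta' Int_def)
  also have "\<dots> = ?M"
  proof (intro subset_antisym subsetI)
    fix g assume "g \<in> \<Union>?S \<inter> {(x, a, y). y \<in> Y \<and> x \<in> Y}"
    then obtain n m U V where "g \<in> shift_groupoid_basic G n m U V" "g \<in> {(x, a, y). y \<in> Y \<and> x \<in> Y}"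
      by blast
    then show "g \<in> ?M" by (auto simp: shift_groupoid_basic_def funpow_shift)
  next
    fix g assume "g \<in> ?M"
    then obtain x y n m where g: "g = (x, int n - int m, y)" "x \<in> Y" "y \<in> Y" "suffix n x = suffix m y"
      by blast
    then have "g \<in> shift_groupoid_basic G n m Y Y"
      by (auto simp: shift_groupoid_basic_def funpow_shift)
    moreover have "shift_groupoid_basic G n m Y Y \<in> ?S" using clopen by blast
    ultimately show "g \<in> \<Union>?S \<inter> {(x, a, y). y \<in> Y \<and> x \<in> Y}" using g by blast
  qed
  finally show ?thesis .
qed

lemma openin_gmor_basic:
  assumes "clopenin (shift_topology G) U" "clopenin (shift_topology G) V"
  shows "openin (gmor Y_groupoid) (topspace (gmor Y_groupoid) \<inter> shift_groupoid_basic G n m U V)"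
proof -
  have "openin (gmor (shift_groupoid G)) (shift_groupoid_basic G n m U V)"
    using assms by (auto simp: shift_groupoid_def intro!: topology_generated_by_Basis)
  then have "openin (gmor Y_groupoid)
      (shift_groupoid_basic G n m U V \<inter> {g. gsource (shift_groupoid G) g \<in> Y \<and> grange (shift_groupoid G) g \<in> Y})"
    by (auto simp: groupoid_restrict_def openin_subtopology)
  moreover have "openin (gmor Y_groupoid) (topspace (gmor Y_groupoid))" by simp
  ultimately have "openin (gmor Y_groupoid) (topspace (gmor Y_groupoid) \<inter>
      (shift_groupoid_basic G n m U V \<inter> {g. gsource (shift_groupoid G) g \<in> Y \<and> grange (shift_groupoid G) g \<in> Y}))"
    by blast
  moreover have "topspace (gmor Y_groupoid) \<inter>
      (shift_groupoid_basic G n m U V \<inter> {g. gsource (shift_groupoid G) g \<in> Y \<and> grange (shift_groupoid G) g \<in> Y})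
    = topspace (gmor Y_groupoid) \<inter> shift_groupoid_basic G n m U V"
    by (auto simp: topspace_gmor gsource_shift_groupoid grange_shift_groupoid)
  ultimately show ?thesis by simp
qed

text \<open>
  The morphisms near \<open>(x, k, y)\<close> are those of the form \<open>(x', n - m, y')\<close> with \<open>x'\<close> near \<open>x\<close>,
  \<open>y'\<close> near \<open>y\<close> and equal tails after deleting \<open>n\<close> and \<open>m\<close> letters, for any one pair \<open>n, m\<close>
  witnessing that \<open>(x, k, y)\<close> is a morphism.
\<close>

lemma openin_gmorI:
  assumes U: "U \<subseteq> topspace (gmor Y_groupoid)"
    and loc: "\<And>x k y. (x, k, y) \<in> U \<Longrightarrow> \<exists>n m l. k = int n - int m \<and> suffix n x = suffix m y \<and>
      (\<forall>x'\<in>Y. \<forall>y'\<in>Y. prefix l x' = prefix l x \<longrightarrow> prefix l y' = prefix l y \<longrightarrow>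
         suffix n x' = suffix m y' \<longrightarrow> (x', k, y') \<in> U)"
  shows "openin (gmor Y_groupoid) U"
proof (subst openin_subopen, intro ballI)
  fix g assume g: "g \<in> U"
  obtain x k y where xky: "g = (x, k, y)" by (cases g)
  from loc[OF g[unfolded xky]] obtain n m l where k: "k = int n - int m" "suffix n x = suffix m y"
    and l: "\<And>x' y'. x' \<in> Y \<Longrightarrow> y' \<in> Y \<Longrightarrow> prefix l x' = prefix l x \<Longrightarrow> prefix l y' = prefix l y \<Longrightarrow>
         suffix n x' = suffix m y' \<Longrightarrow> (x', k, y') \<in> U"
    by blast
  have xy: "x \<in> Y" "y \<in> Y" using U g xky by (auto simp: topspace_gmor)
  let ?C = "\<lambda>w. {y \<in> shift_space G. prefix l y = prefix l w}"
  let ?B = "topspace (gmor Y_groupoid) \<inter> shift_groupoid_basic G n m (?C x) (?C y)"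
  have "openin (gmor Y_groupoid) ?B"
    using xy Y_subset by (intro openin_gmor_basic clopenin_cylinder) auto
  moreover have "g \<in> shift_groupoid_basic G n m (?C x) (?C y)"
    using xy Y_subset k unfolding xky shift_groupoid_basic_def funpow_shift by blast
  moreover have "?B \<subseteq> U"
  proof
    fix h assume h: "h \<in> ?B"
    then obtain x' y' where h': "h = (x', int n - int m, y')" "prefix l x' = prefix l x"
        "prefix l y' = prefix l y" "suffix n x' = suffix m y'"
      by (auto simp: shift_groupoid_basic_def funpow_shift)
    moreover have "x' \<in> Y" "y' \<in> Y" using h h'(1) by (auto simp: topspace_gmor)
    ultimately show "h \<in> U" using l k by simp
  qed
  ultimately show "\<exists>T. openin (gmor Y_groupoid) T \<and> g \<in> T \<and> T \<subseteq> U"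
    using g U by blast
qed

lemma continuous_map_gsource: "continuous_map (gmor Y_groupoid) Y_top (gsource Y_groupoid)"
  unfolding continuous_map topspace_Y_top
proof (intro conjI allI impI)
  show "gsource Y_groupoid ` topspace (gmor Y_groupoid) \<subseteq> Y"
    by (auto simp: topspace_gmor gsource_Y_groupoid)
next
  fix V assume V: "openin Y_top V"
  show "openin (gmor Y_groupoid) {g \<in> topspace (gmor Y_groupoid). gsource Y_groupoid g \<in> V}"
  proof (rule openin_gmorI)
    fix x k y
    assume A: "(x, k, y) \<in> {g \<in> topspace (gmor Y_groupoid). gsource Y_groupoid g \<in> V}"
    then obtain n m where nm: "k = int n - int m" "suffix n x = suffix m y"
      by (auto simp: topspace_gmor)
    have "y \<in> V" using A by (simp add: gsource_Y_groupoid)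
    then obtain l where "\<And>y'. y' \<in> Y \<Longrightarrow> prefix l y' = prefix l y \<Longrightarrow> y' \<in> V"
      using V unfolding openin_Y_top by blast
    with nm show "\<exists>n m l. k = int n - int m \<and> suffix n x = suffix m y \<and>
        (\<forall>x'\<in>Y. \<forall>y'\<in>Y. prefix l x' = prefix l x \<longrightarrow> prefix l y' = prefix l y \<longrightarrow>
           suffix n x' = suffix m y' \<longrightarrow>
           (x', k, y') \<in> {g \<in> topspace (gmor Y_groupoid). gsource Y_groupoid g \<in> V})"
      by (intro exI[of _ n] exI[of _ m] exI[of _ l]) (auto simp: topspace_gmor gsource_Y_groupoid)
  qed auto
qed

lemma compact_space_Y_top: "compact_space Y_top"
  using clopen compact_space_shift_topology
  by (simp add: clopenin_def closedin_compact_space compact_space_subtopology)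

lemma Hausdorff_space_Y_top: "Hausdorff_space Y_top"
  unfolding shift_topology_def
  by (intro Hausdorff_space_subtopology) (simp add: Hausdorff_space_product_topology)

lemma carrier_full_group_iff:
  "f \<in> carrier (topological_full_group Y_groupoid) \<longleftrightarrow>
     f \<in> Bij Y \<and> homeomorphic_map Y_top Y_top f \<and>
     (\<exists>U. groupoid_bisection Y_groupoid U \<and>
        f = (\<lambda>x\<in>Y. grange Y_groupoid (the_inv_into U (gsource Y_groupoid) x)))"
  by (auto simp: topological_full_group_def homeo_group_def gobj_Y_groupoid topspace_Y_top
      simp del: topspace_subtopology)

text \<open>
  Near the morphism of the bisection with source \<open>x\<close>, the integer component and the two numbers of
  deleted letters are constant, because the source map is open on the bisection. By continuity,
  the part of \<open>f y\<close> that is not a tail of \<open>y\<close> is also constant for \<open>y\<close> near \<open>x\<close>.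
\<close>

lemma full_group_exchanges_prefixes:
  assumes "f \<in> carrier (topological_full_group Y_groupoid)"
  shows "\<exists>K\<ge>N. \<exists>\<beta>. exchanges_prefixes Y N f K \<beta>"
proof -
  let ?s = "gsource Y_groupoid" and ?r = "grange Y_groupoid"
  from assms obtain U where fB: "f \<in> Bij Y" and fh: "homeomorphic_map Y_top Y_top f"
    and bis: "groupoid_bisection Y_groupoid U"
    and fU: "f = (\<lambda>x\<in>Y. ?r (the_inv_into U ?s x))"
    unfolding carrier_full_group_iff by blast
  have Usub: "U \<subseteq> topspace (gmor Y_groupoid)" and
    sh: "homeomorphic_map (subtopology (gmor Y_groupoid) U) Y_top ?s"
    using bis by (auto simp: groupoid_bisection_def clopenin_def gobj_Y_groupoid dest: openin_subset)
  then have tU: "topspace (subtopology (gmor Y_groupoid) U) = U" by auto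
  have inj: "inj_on ?s U" using homeomorphic_imp_injective_map[OF sh] by (simp only: tU)
  have img: "?s ` U = Y"
    using homeomorphic_imp_surjective_map[OF sh] by (simp only: tU topspace_Y_top)
  have fr: "f (?s g) = ?r g" if "g \<in> U" for g
    using that img fU inj by (auto simp: the_inv_into_f_f)
  \<comment> \<open>\<open>f\<close> exchanges the prefix \<open>w\<close> for a single word \<open>b\<close> on the whole cylinder of \<open>w\<close>\<close>
  let ?Q = "\<lambda>w. \<exists>b. N \<le> length b \<and>
    (\<forall>y\<in>Y. prefix (length w) y = w \<longrightarrow> f y = b \<frown> suffix (length w) y)"
  have "\<exists>n. ?Q (prefix n x)" if x: "x \<in> Y" for x
  proof -
    have "x \<in> ?s ` U" using x by (simp only: img)
    then obtain g where g: "g \<in> U" "?s g = x" by auto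
    then obtain n m where nm: "g = (f x, int n - int m, x)" "suffix n (f x) = suffix m x"
      using fr[OF g(1)] Usub by (auto simp: topspace_gmor gsource_Y_groupoid grange_Y_groupoid)
    let ?B = "topspace (gmor Y_groupoid) \<inter> shift_groupoid_basic G n m Y Y"
    have "openin (subtopology (gmor Y_groupoid) U) (?B \<inter> U)"
      using openin_gmor_basic[OF clopen clopen] by (rule openin_subtopology_Int)
    then have "openin Y_top (?s ` (?B \<inter> U))"
      using homeomorphic_imp_open_map[OF sh] by (simp add: open_map_def)
    moreover have "g \<in> ?B \<inter> U"
      using g x nm Usub img fr[OF g(1)]
      by (auto simp: shift_groupoid_basic_def funpow_shift topspace_gmor)
    then have "x \<in> ?s ` (?B \<inter> U)" using g by blast
    ultimately have "\<exists>l. \<forall>y\<in>Y. prefix l y = prefix l x \<longrightarrow> y \<in> ?s ` (?B \<inter> U)"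
      by (rule openin_Y_topD)
    then obtain l where l: "\<And>y. y \<in> Y \<Longrightarrow> prefix l y = prefix l x \<Longrightarrow> y \<in> ?s ` (?B \<inter> U)"
      by blast
    have tail: "suffix n (f y) = suffix m y" if y: "y \<in> Y" "prefix l y = prefix l x" for y
    proof -
      obtain h where h: "h \<in> ?B \<inter> U" "y = ?s h" using l[OF y] by blast
      then have "f y = ?r h" using fr by simp
      with h show ?thesis
        by (auto simp: shift_groupoid_basic_def funpow_shift gsource_Y_groupoid grange_Y_groupoid)
    qed
    have fY: "f y \<in> Y" if "y \<in> Y" for y
      using fB that by (auto simp: Bij_def bij_betw_def)
    have "openin Y_top {z \<in> Y. prefix n z = prefix n (f x)}"
      unfolding openin_Y_top by (auto intro!: exI[of _ n])
    then have "openin Y_top {y \<in> Y. f y \<in> {z \<in> Y. prefix n z = prefix n (f x)}}"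
      using homeomorphic_imp_continuous_map[OF fh]
      unfolding continuous_map topspace_Y_top by blast
    moreover have "x \<in> {y \<in> Y. f y \<in> {z \<in> Y. prefix n z = prefix n (f x)}}"
      using x fY by blast
    ultimately have "\<exists>l'. \<forall>y\<in>Y. prefix l' y = prefix l' x \<longrightarrow>
        y \<in> {y \<in> Y. f y \<in> {z \<in> Y. prefix n z = prefix n (f x)}}"
      by (rule openin_Y_topD)
    then obtain l' where
      l': "\<And>y. y \<in> Y \<Longrightarrow> prefix l' y = prefix l' x \<Longrightarrow> prefix n (f y) = prefix n (f x)"
      by auto
    \<comment> \<open>long enough for all the conditions to hold on the cylinder, to contain the \<open>m\<close> deleted
        letters, and to leave a new prefix of length at least \<open>N\<close>\<close>
    define L where "L = l + l' + m + N"
    have "f y = (prefix n (f x) @ drop m (prefix L x)) \<frown> suffix L y"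
      if y: "y \<in> Y" "prefix L y = prefix L x" for y
    proof -
      have "prefix l y = prefix l x" "prefix l' y = prefix l' x"
        using prefix_le_eq[OF y(2), of l] prefix_le_eq[OF y(2), of l'] by (simp_all add: L_def)
      then have "f y = prefix n (f x) \<frown> suffix m y"
        using tail[OF y(1)] l'[OF y(1)] prefix_suffix[of "f y" n] by simp
      also have "suffix m y = drop m (prefix L x) \<frown> suffix L y"
        unfolding y(2)[symmetric] by (simp add: L_def)
      finally show ?thesis by (simp only: conc_conc)
    qed
    moreover have "N \<le> length (prefix n (f x) @ drop m (prefix L x))" by (simp add: L_def)
    ultimately have "?Q (prefix L x)" by (intro exI conjI) auto
    then show ?thesis by blast
  qed
  moreover have "?Q (w @ u)" if Q: "?Q w" for w u
  proof -
    obtain b where b: "N \<le> length b"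
        "\<And>y. y \<in> Y \<Longrightarrow> prefix (length w) y = w \<Longrightarrow> f y = b \<frown> suffix (length w) y"
      using Q by blast
    have "f y = (b @ u) \<frown> suffix (length (w @ u)) y"
      if y: "y \<in> Y" "prefix (length (w @ u)) y = w @ u" for y
    proof -
      have "prefix (length w) y @ prefix (length u) (suffix (length w) y) = w @ u"
        using y(2) by (simp only: length_append prefix_add)
      then have pw: "prefix (length w) y = w" "prefix (length u) (suffix (length w) y) = u"
        by simp_all
      have "f y = b \<frown> suffix (length w) y" by (rule b(2)[OF y(1) pw(1)])
      also have "suffix (length w) y = u \<frown> suffix (length (w @ u)) y"
        using prefix_suffix[of "suffix (length w) y" "length u", unfolded pw(2)] by simp
      finally show ?thesis by (simp only: conc_conc)
    qed
    with b(1) show ?thesis by (intro exI[of _ "b @ u"]) auto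
  qed
  ultimately obtain n where n: "\<And>x m. x \<in> Y \<Longrightarrow> n \<le> m \<Longrightarrow> ?Q (prefix m x)"
    using uniform_prefix_length[of Y ?Q] clopen unfolding clopenin_def by blast
  define K where "K = max n N"
  have "\<exists>b. N \<le> length b \<and> (\<forall>y\<in>Y. prefix K y = prefix K x \<longrightarrow> f y = b \<frown> suffix K y)"
    if "x \<in> Y" for x
    using n[OF that, of K] by (simp add: K_def)
  then obtain b where b: "\<And>x. x \<in> Y \<Longrightarrow>
      N \<le> length (b x) \<and> (\<forall>y\<in>Y. prefix K y = prefix K x \<longrightarrow> f y = b x \<frown> suffix K y)"
    by metis
  define \<beta> where "\<beta> w = b (SOME x. x \<in> Y \<and> prefix K x = w)" for w
  have "exchanges_prefixes Y N f K \<beta>"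
    unfolding exchanges_prefixes_def
  proof
    fix x assume x: "x \<in> Y"
    let ?x = "SOME x'. x' \<in> Y \<and> prefix K x' = prefix K x"
    have "?x \<in> Y \<and> prefix K ?x = prefix K x" by (rule someI[of _ x]) (simp add: x)
    then show "N \<le> length (\<beta> (prefix K x)) \<and> f x = \<beta> (prefix K x) \<frown> suffix K x"
      using b[of ?x] x by (simp add: \<beta>_def)
  qed
  then show ?thesis by (intro exI[of _ K]) (auto simp: K_def)
qed

text \<open>
  Conversely, a prefix exchange \<open>f\<close> is realised by the bisection of the morphisms
  \<open>(f y, k y, y)\<close>, where the locally constant \<open>k y\<close> is the difference of the lengths of the
  exchanged prefixes.
\<close>

lemma exchanges_prefixes_full_group:
  assumes fB: "f \<in> Bij Y" and ex: "exchanges_prefixes Y N f K \<beta>"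
  shows "f \<in> carrier (topological_full_group Y_groupoid)"
proof -
  let ?s = "gsource Y_groupoid" and ?r = "grange Y_groupoid"
  have fY: "f y \<in> Y" if "y \<in> Y" for y
    using fB that by (auto simp: Bij_def bij_betw_def)
  have cont: "continuous_map Y_top Y_top f"
    unfolding continuous_map topspace_Y_top
  proof (intro conjI allI impI)
    fix V assume V: "openin Y_top V"
    show "openin Y_top {x \<in> Y. f x \<in> V}"
      unfolding openin_Y_top
    proof (intro conjI ballI)
      fix x assume x: "x \<in> {x \<in> Y. f x \<in> V}"
      then obtain n where n: "\<And>z. z \<in> Y \<Longrightarrow> prefix n z = prefix n (f x) \<Longrightarrow> z \<in> V"
        using V unfolding openin_Y_top by blast
      have "y \<in> {x \<in> Y. f x \<in> V}" if "y \<in> Y" "prefix (K + n) y = prefix (K + n) x" for y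
        using n[of "f y"] fY that x exchanges_prefixes_local[OF ex, of y x n] by simp
      then show "\<exists>n. \<forall>y\<in>Y. prefix n y = prefix n x \<longrightarrow> y \<in> {x \<in> Y. f x \<in> V}" by blast
    qed auto
  qed (use fY in auto)
  have fh: "homeomorphic_map Y_top Y_top f"
    using fB
    by (intro continuous_imp_homeomorphic_map[OF cont compact_space_Y_top Hausdorff_space_Y_top])
      (auto simp: Bij_def bij_betw_def topspace_Y_top simp del: topspace_subtopology)
  define k where "k y = int (length (\<beta> (prefix K y))) - int K" for y
  define j where "j y = (f y, k y, y)" for y
  let ?U = "j ` Y"
  have ftail: "suffix (length (\<beta> (prefix K y))) (f y) = suffix K y" if "y \<in> Y" for y
    using ex that by (simp add: exchanges_prefixes_def)
  have Usub: "?U \<subseteq> topspace (gmor Y_groupoid)"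
    using fY ftail by (force simp: topspace_gmor j_def k_def)
  have k_cong: "k y' = k y" if "prefix (K + l) y' = prefix (K + l) y" for y y' l
    using prefix_le_eq[OF that, of K] by (simp add: k_def)
  have Uopen: "openin (gmor Y_groupoid) ?U"
  proof (rule openin_gmorI[OF Usub])
    fix x a y assume "(x, a, y) \<in> ?U"
    then have y: "y \<in> Y" "x = f y" "a = k y" by (auto simp: j_def)
    let ?n = "length (\<beta> (prefix K y))"
    have "(x', a, y') \<in> ?U"
      if x': "x' \<in> Y" and y': "y' \<in> Y" and px: "prefix (K + ?n) x' = prefix (K + ?n) x"
        and py: "prefix (K + ?n) y' = prefix (K + ?n) y" and tl: "suffix ?n x' = suffix K y'" for x' y'
    proof -
      have "prefix ?n x' = prefix ?n (f y)" using prefix_le_eq[OF px, of ?n] y(2) by simp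
      also have "\<dots> = \<beta> (prefix K y)" using ex y(1) by (simp add: exchanges_prefixes_def)
      also have "\<dots> = \<beta> (prefix K y')" using prefix_le_eq[OF py, of K] by simp
      finally have "x' = \<beta> (prefix K y') \<frown> suffix K y'"
        using prefix_suffix[of x' ?n] tl by simp
      then have "x' = f y'" using ex y' by (simp add: exchanges_prefixes_def)
      then show ?thesis using y' y(3) k_cong[OF py] by (auto simp: j_def)
    qed
    then show "\<exists>n m l. a = int n - int m \<and> suffix n x = suffix m y \<and>
        (\<forall>x'\<in>Y. \<forall>y'\<in>Y. prefix l x' = prefix l x \<longrightarrow> prefix l y' = prefix l y \<longrightarrow>
           suffix n x' = suffix m y' \<longrightarrow> (x', a, y') \<in> ?U)"
      using y ftail[OF y(1)]
      by (intro exI[of _ ?n] exI[of _ K] exI[of _ "K + ?n"]) (auto simp: k_def)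
  qed
  \<comment> \<open>a morphism \<open>(x, a, y)\<close> outside the bisection differs from \<open>(f y, k y, y)\<close> in the integer,
      which is locally constant, or in a letter of \<open>x\<close>, which can be tested on a cylinder\<close>
  have Uclosed: "openin (gmor Y_groupoid) (topspace (gmor Y_groupoid) - ?U)"
  proof (rule openin_gmorI)
    fix x a y assume A: "(x, a, y) \<in> topspace (gmor Y_groupoid) - ?U"
    then have y: "x \<in> Y" "y \<in> Y" and ne: "\<not> (x = f y \<and> a = k y)"
      by (auto simp: topspace_gmor j_def)
    from A obtain n m where nm: "a = int n - int m" "suffix n x = suffix m y"
      by (auto simp: topspace_gmor)
    obtain l where l: "a = k y \<Longrightarrow> prefix l x \<noteq> prefix l (f y)"
    proof (cases "a = k y")
      case True
      with ne have "x \<noteq> f y" by blast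
      then obtain i where "x i \<noteq> f y i" by (auto simp: fun_eq_iff)
      then have "prefix (Suc i) x \<noteq> prefix (Suc i) (f y)" by (auto simp: prefix_eq_iff)
      then show ?thesis using that by blast
    qed (use that in blast)
    have "(x', a, y') \<notin> ?U"
      if y': "y' \<in> Y" and px: "prefix (K + l) x' = prefix (K + l) x"
        and py: "prefix (K + l) y' = prefix (K + l) y" for x' y'
    proof
      assume "(x', a, y') \<in> ?U"
      then have "x' = f y'" "a = k y'" by (auto simp: j_def)
      moreover from this have "a = k y" using k_cong[OF py] by simp
      moreover have "prefix l (f y') = prefix l (f y)"
        using exchanges_prefixes_local[OF ex y' y(2) py] .
      ultimately show False using l prefix_le_eq[OF px, of l] by simp
    qed
    with nm show "\<exists>n m l. a = int n - int m \<and> suffix n x = suffix m y \<and>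
        (\<forall>x'\<in>Y. \<forall>y'\<in>Y. prefix l x' = prefix l x \<longrightarrow> prefix l y' = prefix l y \<longrightarrow>
           suffix n x' = suffix m y' \<longrightarrow> (x', a, y') \<in> topspace (gmor Y_groupoid) - ?U)"
      by (intro exI[of _ n] exI[of _ m] exI[of _ "K + l"]) (auto simp: topspace_gmor)
  qed auto
  \<comment> \<open>the inverse \<open>j\<close> of the source map is continuous: near \<open>y\<close>, the tail condition of a basic set
      with \<open>n\<close> smaller than the length of the new prefix compares fixed letters only\<close>
  let ?S = "{shift_groupoid_basic G n m U V | n m U V.
     clopenin (shift_topology G) U \<and> clopenin (shift_topology G) V}"
  have "openin Y_top (j -` B \<inter> Y)" if B: "B \<in> ?S" for B
  proof -
    from B obtain n m U V where B: "B = shift_groupoid_basic G n m U V"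
      and U: "openin (shift_topology G) U" and V: "openin (shift_topology G) V"
      by (auto simp: clopenin_def)
    have jB: "j y \<in> B \<longleftrightarrow> f y \<in> U \<and> y \<in> V \<and> k y = int n - int m \<and> suffix n (f y) = suffix m y" for y
      by (auto simp: B j_def shift_groupoid_basic_def funpow_shift)
    show ?thesis
      unfolding openin_Y_top
    proof (intro conjI ballI)
      fix y assume "y \<in> j -` B \<inter> Y"
      then have y: "y \<in> Y" "f y \<in> U" "y \<in> V" "k y = int n - int m" "suffix n (f y) = suffix m y"
        using jB by auto
      obtain l1 where "\<forall>z\<in>shift_space G. prefix l1 z = prefix l1 (f y) \<longrightarrow> z \<in> U"
        using U y(2) unfolding openin_shift_topology by blast
      then have l1: "\<And>z. z \<in> Y \<Longrightarrow> prefix l1 z = prefix l1 (f y) \<Longrightarrow> z \<in> U"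
        using Y_subset by blast
      obtain l2 where "\<forall>z\<in>shift_space G. prefix l2 z = prefix l2 y \<longrightarrow> z \<in> V"
        using V y(3) unfolding openin_shift_topology by blast
      then have l2: "\<And>z. z \<in> Y \<Longrightarrow> prefix l2 z = prefix l2 y \<Longrightarrow> z \<in> V"
        using Y_subset by blast
      have "j z \<in> B" if z: "z \<in> Y" and pz: "prefix (K + (l1 + l2)) z = prefix (K + (l1 + l2)) y" for z
      proof -
        have "prefix (l1 + l2) (f z) = prefix (l1 + l2) (f y)"
          using exchanges_prefixes_local[OF ex z y(1) pz] .
        then have "f z \<in> U" using fY[OF z] by (intro l1) (auto intro: prefix_le_eq)
        moreover have "z \<in> V" using z pz by (intro l2) (auto intro: prefix_le_eq)
        moreover have kz: "k z = int n - int m" using k_cong[OF pz] y(4) by simp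
        moreover have "suffix n (f z) = suffix m z"
        proof
          fix i
          have pK: "prefix K z = prefix K y" using pz by (rule prefix_le_eq) simp
          let ?p = "length (\<beta> (prefix K y))"
          have p: "int ?p - int K = int n - int m" using y(4) by (simp add: k_def)
          have fz: "f z = \<beta> (prefix K y) \<frown> suffix K z" and fy: "f y = \<beta> (prefix K y) \<frown> suffix K y"
            using ex z y(1) pK by (simp_all add: exchanges_prefixes_def)
          show "suffix n (f z) i = suffix m z i"
          proof (cases "n + i < ?p")
            case True
            then have "suffix n (f z) i = suffix n (f y) i" by (simp add: fz fy)
            also have "\<dots> = y (m + i)" by (simp add: y(5))
            also have "\<dots> = z (m + i)" using pK True p by (auto simp: prefix_eq_iff)
            finally show ?thesis by simp
          next
            case False
            moreover from this have "K + (n + i - ?p) = m + i" using p by linarith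
            ultimately show ?thesis by (simp add: fz)
          qed
        qed
        ultimately show ?thesis using jB by blast
      qed
      then show "\<exists>n. \<forall>z\<in>Y. prefix n z = prefix n y \<longrightarrow> z \<in> j -` B \<inter> Y" by blast
    qed auto
  qed
  moreover have "j ` Y \<subseteq> \<Union>?S"
  proof -
    have "\<Union>?S \<supseteq> topspace (gmor Y_groupoid)"
      by (auto simp: groupoid_restrict_def shift_groupoid_def)
    with Usub show ?thesis by blast
  qed
  ultimately have "continuous_map Y_top (topology_generated_by ?S) j"
    by (intro continuous_on_generated_topo) (simp_all only: topspace_Y_top)
  then have j_cont: "continuous_map Y_top (gmor Y_groupoid) j"
    using fY by (auto simp: groupoid_restrict_def shift_groupoid_def continuous_map_in_subtopology
        topspace_Y_top j_def simp del: topspace_subtopology)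
  have sh: "homeomorphic_map (subtopology (gmor Y_groupoid) ?U) Y_top ?s"
    unfolding homeomorphic_map_maps homeomorphic_maps_def
  proof (intro exI[of _ j] conjI)
    show "continuous_map (subtopology (gmor Y_groupoid) ?U) Y_top ?s"
      using continuous_map_gsource by (rule continuous_map_from_subtopology)
    show "continuous_map Y_top (subtopology (gmor Y_groupoid) ?U) j"
      using j_cont by (simp add: continuous_map_in_subtopology topspace_Y_top del: topspace_subtopology)
  qed (use Usub in \<open>auto simp: j_def gsource_Y_groupoid\<close>)
  have "homeomorphic_map (subtopology (gmor Y_groupoid) ?U) Y_top (f \<circ> ?s)"
    using homeomorphic_map_compose[OF sh fh] .
  then have rh: "homeomorphic_map (subtopology (gmor Y_groupoid) ?U) Y_top ?r"
    by (rule homeomorphic_map_eq[OF _ _]) (auto simp: j_def gsource_Y_groupoid grange_Y_groupoid)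
  have "groupoid_bisection Y_groupoid ?U"
    using Uopen Uclosed Usub sh rh
    by (simp add: groupoid_bisection_def clopenin_def closedin_def gobj_Y_groupoid)
  moreover have "f = (\<lambda>x\<in>Y. ?r (the_inv_into ?U ?s x))"
  proof
    fix y
    show "f y = (\<lambda>x\<in>Y. ?r (the_inv_into ?U ?s x)) y"
    proof (cases "y \<in> Y")
      case True
      have "inj_on ?s ?U" by (auto simp: inj_on_def j_def gsource_Y_groupoid)
      then have "the_inv_into ?U ?s (?s (j y)) = j y" using True by (intro the_inv_into_f_f) auto
      moreover have "?s (j y) = y" "?r (j y) = f y"
        by (simp_all add: j_def gsource_Y_groupoid grange_Y_groupoid)
      ultimately show ?thesis using True by simp
    next
      case False
      then show ?thesis using fB by (simp add: Bij_def extensional_def)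
    qed
  qed
  ultimately show ?thesis using fB fh unfolding carrier_full_group_iff by blast
qed

end

section \<open>The tree of finite paths\<close>

text \<open>
  The length \<open>N\<close> is so large that membership in \<open>Y\<close> can be read off from \<open>N\<close> letters, and that the
  root of the tree has at least two children. With a single child, the vertices other than the root
  would form a proper subtree containing all vertices of every label.
\<close>

locale path_tree = branching_graph G + clopen_subshift G Y
  for G :: "('v, 'e) pre_digraph" and Y :: "(nat \<Rightarrow> 'e) set" +
  fixes N :: nat
  assumes N_pos: "0 < N"
    and window: "\<And>x y. x \<in> Y \<Longrightarrow> y \<in> shift_space G \<Longrightarrow> prefix N y = prefix N x \<Longrightarrow> y \<in> Y"
    and two_prefixes: "\<exists>x\<in>Y. \<exists>y\<in>Y. prefix N x \<noteq> prefix N y"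
begin

definition words :: "'e list set" where
  "words = {prefix n x | n x. N \<le> n \<and> x \<in> Y}"

definition target :: "'e list \<Rightarrow> 'v" where
  "target w = head G (last w)"

text \<open>Words shorter than \<open>N\<close> are not vertices, so a word of length \<open>N\<close> is a child of the root.\<close>

definition parent :: "'e list \<Rightarrow> 'e list" where
  "parent w = (if length w \<le> N then [] else butlast w)"

text \<open>In a tree an arc is determined by its end, so the arcs are the vertices other than the root.\<close>

definition path_graph :: "('e list, 'e list) pre_digraph" where
  "path_graph = \<lparr>verts = insert [] words, arcs = words, tail = parent, head = id\<rparr>"

definition path_colouring :: "('e list, 'e list, 'v, 'e) colouring" where
  "path_colouring = \<lparr>labels = verts G, lab = target,
     colours = (\<lambda>v w. {e \<in> arcs G. tail G e = v \<and> head G e = w}), ccol = last\<rparr>"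

lemma prefix_in_words: "x \<in> Y \<Longrightarrow> N \<le> n \<Longrightarrow> prefix n x \<in> words"
  by (auto simp: words_def)

lemma words_length: "w \<in> words \<Longrightarrow> N \<le> length w"
  by (auto simp: words_def)

lemma Nil_notin_words [simp]: "[] \<notin> words"
  using N_pos words_length by fastforce

lemma wordsE:
  assumes "w \<in> words"
  obtains x where "x \<in> Y" "prefix (length w) x = w"
  using assms by (auto simp: words_def)

lemma suffix_start:
  assumes "x \<in> Y" "N \<le> n"
  shows "suffix n x \<in> shift_space G \<and> tail G (suffix n x 0) = target (prefix n x)"
proof -
  have x: "x \<in> shift_space G" using assms Y_subset by blast
  obtain m where "n = Suc m" using assms N_pos by (cases n) auto
  with x suffix_in_shift_space[OF x] show ?thesis by (auto simp: shift_space_def target_def)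
qed

lemma target_in_verts: "w \<in> words \<Longrightarrow> target w \<in> verts G"
  using Y_subset N_pos
  by (auto simp: words_def target_def shift_space_def last_conv_nth subset_iff)

lemma conc_in_Y:
  assumes w: "w \<in> words" and z: "z \<in> shift_space G" "tail G (z 0) = target w"
  shows "w \<frown> z \<in> Y"
proof -
  obtain x where x: "x \<in> Y" "prefix (length w) x = w" using w by (rule wordsE)
  have Nw: "N \<le> length w" using w by (rule words_length)
  have "target w = head G (x (length w - 1))"
  proof -
    have "last (prefix (length w) x) = x (length w - 1)"
      using Nw N_pos by (subst last_conv_nth) auto
    then show ?thesis by (simp only: x(2) target_def)
  qed
  then have "prefix (length w) x \<frown> z \<in> shift_space G"
    using x Y_subset z Nw N_pos by (intro prefix_conc_in_shift_space) auto
  then have "w \<frown> z \<in> shift_space G" by (simp only: x(2))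
  moreover have "prefix N (w \<frown> z) = prefix N x"
    using Nw x(2) prefix_le_eq[of "w \<frown> z" "length w" x N] by simp
  ultimately show ?thesis using window x(1) by blast
qed

lemma extension_in_Y:
  assumes "w \<in> words"
  obtains z where "z \<in> shift_space G" "tail G (z 0) = target w" "w \<frown> z \<in> Y"
  using path_from_vertex[OF target_in_verts[OF assms]] conc_in_Y[OF assms] that by blast

lemma words_take:
  assumes "w @ u \<in> words" "N \<le> length w"
  shows "w \<in> words"
proof -
  obtain x where x: "x \<in> Y" "prefix (length (w @ u)) x = w @ u" using assms(1) by (rule wordsE)
  then have "prefix (length w) x @ prefix (length u) (suffix (length w) x) = w @ u"
    by (simp only: length_append prefix_add)
  then have "prefix (length w) x = w" by simp
  with prefix_in_words[OF x(1) assms(2)] show ?thesis by simp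
qed

text \<open>
  A word can be continued by exactly the paths issuing from its last vertex, so words with the same
  last vertex have the same continuations.
\<close>

lemma words_replace:
  assumes w: "w \<in> words" and w': "w' \<in> words" and t: "target w = target w'"
    and wu: "w @ u \<in> words"
  shows "w' @ u \<in> words" "target (w' @ u) = target (w @ u)"
proof -
  obtain x where x: "x \<in> Y" "prefix (length (w @ u)) x = w @ u" using wu by (rule wordsE)
  have "prefix (length w) x @ prefix (length u) (suffix (length w) x) = w @ u"
    using x(2) by (simp only: length_append prefix_add)
  then have px: "prefix (length w) x = w" "prefix (length u) (suffix (length w) x) = u"
    by simp_all
  then have "w' \<frown> suffix (length w) x \<in> Y"
    using suffix_start[OF x(1) words_length[OF w]] t by (intro conc_in_Y[OF w']) auto
  moreover have "prefix (length (w' @ u)) (w' \<frown> suffix (length w) x) = w' @ u"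
    using px(2) by simp
  ultimately show "w' @ u \<in> words"
    using words_length[OF w'] prefix_in_words by (metis le_add1 le_trans length_append)
  show "target (w' @ u) = target (w @ u)"
    using t by (cases "u = []") (auto simp: target_def)
qed

lemma snoc_in_words_iff:
  assumes w: "w \<in> words"
  shows "w @ [e] \<in> words \<longleftrightarrow> e \<in> arcs G \<and> tail G e = target w"
proof
  assume we: "w @ [e] \<in> words"
  then obtain x where x: "x \<in> Y" "prefix (length (w @ [e])) x = w @ [e]" by (rule wordsE)
  then have "prefix (length w) x = w" "x (length w) = e" by simp_all
  then show "e \<in> arcs G \<and> tail G e = target w"
    using suffix_start[OF x(1) words_length[OF w]] x(1) Y_subset by (auto simp: shift_space_def)
next
  assume e: "e \<in> arcs G \<and> tail G e = target w"
  obtain z where z: "z \<in> shift_space G" "tail G (z 0) = head G e"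
    using path_from_vertex[of "head G e"] e by auto
  have "[e] \<frown> z \<in> shift_space G \<and> tail G (([e] \<frown> z) 0) = target w"
    using e z by (intro walk_conc_in_shift_space[of _ _ "head G e"])
      (auto simp: awalk_Cons_iff awalk_Nil_iff)
  then have "w \<frown> [e] \<frown> z \<in> Y" by (intro conc_in_Y[OF w]) auto
  then have "prefix (length w + 1) (w \<frown> [e] \<frown> z) \<in> words"
    using words_length[OF w] by (intro prefix_in_words) auto
  then show "w @ [e] \<in> words" by simp
qed

lemma words_of_length_finite: "finite {w \<in> words. length w \<le> n}"
proof (rule finite_subset)
  show "finite {w. set w \<subseteq> arcs G \<and> length w \<le> n}" by (rule finite_lists_length_le) simp
  show "{w \<in> words. length w \<le> n} \<subseteq> {w. set w \<subseteq> arcs G \<and> length w \<le> n}"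
    using Y_subset by (auto simp: words_def shift_space_def subset_iff)
qed

subsection \<open>Parents, children and descendants\<close>

lemma path_graph_simps [simp]:
  "verts path_graph = insert [] words" "arcs path_graph = words"
  "tail path_graph = parent" "head path_graph = id"
  by (simp_all add: path_graph_def)

lemma parent_in_verts: "w \<in> words \<Longrightarrow> parent w \<in> insert [] words"
  using words_take[of "butlast w" "[last w]"] by (cases w rule: rev_cases) (auto simp: parent_def)

lemma parent_short: "w \<in> words \<Longrightarrow> length (parent w) < length w"
  using words_length[of w] N_pos by (auto simp: parent_def)

lemma parent_snoc: "w \<in> words \<Longrightarrow> parent (w @ [e]) = w"
  using words_length[of w] by (auto simp: parent_def)

lemma parent_eq_word:
  assumes "parent w = v" "v \<noteq> []" "w \<in> words"
  shows "w = v @ [last w]"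
  using assms by (cases w rule: rev_cases) (auto simp: parent_def split: if_splits)

sublocale T: wf_digraph path_graph
  using parent_in_verts by unfold_locales auto

lemma awalk_snoc_iff:
  "T.awalk u (p @ [e]) v \<longleftrightarrow> T.awalk u p (parent e) \<and> e \<in> words \<and> v = e"
proof -
  have "T.cas u (p @ [e]) v \<longleftrightarrow> T.cas u p (parent e) \<and> v = e"
    by (induction p arbitrary: u) auto
  then show ?thesis by (auto simp: T.awalk_def)
qed

lemma walk_to_unique:
  assumes "v \<in> insert [] words"
  shows "\<exists>!p. T.awalk [] p v"
  using assms
proof (induction "length v" arbitrary: v rule: less_induct)
  case less
  show ?case
  proof (cases "v = []")
    case True
    have "T.awalk [] p [] \<longleftrightarrow> p = []" for p
      by (cases p rule: rev_cases) (auto simp: awalk_snoc_iff T.awalk_Nil_iff)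
    then show ?thesis using True by auto
  next
    case False
    then have v: "v \<in> words" using less.prems by simp
    from less.hyps[OF parent_short[OF v] parent_in_verts[OF v]]
    obtain p where p: "T.awalk [] p (parent v)" "\<And>q. T.awalk [] q (parent v) \<Longrightarrow> q = p" by blast
    show ?thesis
    proof
      show "T.awalk [] (p @ [v]) v" using p(1) v unfolding awalk_snoc_iff by simp
      show "q = p @ [v]" if "T.awalk [] q v" for q
        using that False p(2) by (cases q rule: rev_cases) (auto simp: awalk_snoc_iff T.awalk_Nil_iff)
    qed
  qed
qed

lemma rooted_tree_path_graph: "rooted_tree path_graph []"
  using walk_to_unique T.wf_digraph by (auto simp: rooted_tree_def)

lemma children_path_graph: "children path_graph v = {w \<in> words. parent w = v}"
  by (auto simp: children_def)

lemma children_word: "w \<in> words \<Longrightarrow> children path_graph w = {w @ [e] | e. e \<in> arcs G \<and> tail G e = target w}"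
proof (intro subset_antisym subsetI)
  fix v assume w: "w \<in> words" and "v \<in> children path_graph w"
  then have v: "v \<in> words" "parent v = w" by (auto simp: children_path_graph)
  moreover from this w have "v = w @ [last v]" by (intro parent_eq_word) auto
  ultimately show "v \<in> {w @ [e] | e. e \<in> arcs G \<and> tail G e = target w}"
    using snoc_in_words_iff[OF w] by (metis (mono_tags, lifting) mem_Collect_eq)
next
  fix v assume w: "w \<in> words" and "v \<in> {w @ [e] | e. e \<in> arcs G \<and> tail G e = target w}"
  then show "v \<in> children path_graph w"
    using snoc_in_words_iff[OF w] parent_snoc[OF w] by (auto simp: children_path_graph)
qed

lemma children_Nil: "children path_graph [] = {w \<in> words. length w = N}"
proof -
  have "parent w = [] \<longleftrightarrow> length w = N" if "w \<in> words" for w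
    using words_length[OF that] N_pos by (cases w rule: rev_cases) (auto simp: parent_def)
  then show ?thesis by (auto simp: children_path_graph)
qed

lemma locally_finite_path_graph: "locally_finite_graph path_graph"
  unfolding locally_finite_graph_def
proof (intro ballI conjI)
  fix v
  have "out_arcs path_graph v \<subseteq> {w \<in> words. length w \<le> length v + N + 1}"
    by (auto simp: parent_def split: if_splits)
  then show "finite (out_arcs path_graph v)" using words_of_length_finite finite_subset by blast
  have "in_arcs path_graph v \<subseteq> {v}" by auto
  then show "finite (in_arcs path_graph v)" using finite_subset by blast
qed

lemma descendants_path_graph:
  assumes v: "v \<in> insert [] words"
  shows "descendants path_graph v = {w \<in> insert [] words. \<exists>u. w = v @ u}"
proof (intro subset_antisym subsetI)
  fix w assume "w \<in> descendants path_graph v"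
  then have "v \<rightarrow>\<^sup>*\<^bsub>path_graph\<^esub> w" by (simp add: descendants_def)
  then show "w \<in> {w \<in> insert [] words. \<exists>u. w = v @ u}"
  proof (induction rule: T.reachable_induct)
    case base
    then show ?case by simp
  next
    case (step x y)
    then have y: "y \<in> words" "parent y = x" by auto
    show ?case
    proof (cases "x = []")
      case True
      then show ?thesis using step.IH y by auto
    next
      case False
      then have "y = x @ [last y]" using y parent_eq_word by blast
      moreover obtain u where "x = v @ u" using step.IH by blast
      ultimately have "y = v @ (u @ [last y])" by simp
      then show ?thesis using y(1) by blast
    qed
  qed
next
  fix w assume "w \<in> {w \<in> insert [] words. \<exists>u. w = v @ u}"
  then have "w \<in> insert [] words" "\<exists>u. w = v @ u" by auto
  then have "v \<rightarrow>\<^sup>*\<^bsub>path_graph\<^esub> w"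
  proof (induction "length w" arbitrary: w rule: less_induct)
    case less
    show ?case
    proof (cases "w = v")
      case True
      then show ?thesis using v by auto
    next
      case False
      with less.prems obtain u where u: "w = v @ u" "u \<noteq> []" by auto
      then have w: "w \<in> words" using less.prems(1) by auto
      have "\<exists>u. parent w = v @ u"
      proof (cases "length w \<le> N")
        case True
        then have "v = []" using u words_length[of v] v by (cases u) auto
        then show ?thesis by simp
      next
        case False
        then show ?thesis using u by (auto simp: parent_def butlast_append)
      qed
      then have "v \<rightarrow>\<^sup>*\<^bsub>path_graph\<^esub> parent w"
        using less.hyps[OF parent_short[OF w] parent_in_verts[OF w]] by blast
      moreover have "parent w \<rightarrow>\<^bsub>path_graph\<^esub> w"
        using w by (intro T.dominatesI[of w]) (auto simp: arc_to_ends_def)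
      ultimately show ?thesis by (rule T.reachable_adj_trans)
    qed
  qed
  then show "w \<in> descendants path_graph v" by (simp add: descendants_def)
qed

lemma verts_complement_forest:
  assumes "S \<subseteq> insert [] words"
  shows "verts (complement_forest path_graph S) =
    {w \<in> insert [] words. \<exists>v\<in>leaves path_graph S. \<exists>u. w = v @ u}"
proof -
  have "descendants path_graph v = {w \<in> insert [] words. \<exists>u. w = v @ u}"
    if "v \<in> leaves path_graph S" for v
    using that assms by (intro descendants_path_graph) (auto simp: leaves_def)
  then show ?thesis by (auto simp: complement_forest_def)
qed

lemma arcs_complement_forest:
  "arcs (complement_forest path_graph S) =
    {w \<in> words. w \<in> verts (complement_forest path_graph S) \<and> parent w \<in> verts (complement_forest path_graph S)}"
  by (auto simp: complement_forest_def)

lemma ends_complement_forest [simp]: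
  "tail (complement_forest path_graph S) = parent" "head (complement_forest path_graph S) = id"
  by (simp_all add: complement_forest_def)

subsection \<open>Subtrees\<close>

text \<open>
  The only arc joining the descendants of \<open>c\<close> to the other vertices is the one into \<open>c\<close>, so a
  connected set meeting both sides contains both ends of that arc.
\<close>

lemma subtree_crossing:
  assumes S: "subtree path_graph S" and c: "c \<in> words"
    and a: "a \<in> S" "a = c @ u" and b: "b \<in> S" "\<nexists>u. b = c @ u"
  shows "c \<in> S \<and> parent c \<in> S"
proof (rule ccontr)
  assume no: "\<not> (c \<in> S \<and> parent c \<in> S)"
  let ?H = "path_graph \<restriction> S"
  interpret H: wf_digraph ?H by unfold_locales auto
  have cw: "c \<noteq> []" using b by auto
  have arc: "(\<exists>u. w = c @ u) \<longleftrightarrow> (\<exists>u. parent w = c @ u)"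
    if "w \<in> words" "w \<in> S" "parent w \<in> S" for w
  proof
    assume "\<exists>u. w = c @ u"
    then obtain u where u: "w = c @ u" by blast
    with no that have "u \<noteq> []" by auto
    then have "parent w = c @ butlast u"
      using u words_length[OF c] by (cases u rule: rev_cases) (auto simp: parent_def butlast_append)
    then show "\<exists>u. parent w = c @ u" ..
  next
    assume "\<exists>u. parent w = c @ u"
    then show "\<exists>u. w = c @ u"
      using cw by (cases w rule: rev_cases) (auto simp: parent_def split: if_splits)
  qed
  interpret M: pair_wf_digraph "mk_symmetric ?H" by (rule H.wellformed_mk_symmetric)
  have "a \<rightarrow>\<^sup>*\<^bsub>mk_symmetric ?H\<^esub> b"
    using S a b by (auto simp: subtree_def connected_def strongly_connected_def)
  then have "\<exists>u. b = c @ u"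
  proof (induction rule: M.reachable_induct)
    case base
    then show ?case using a by blast
  next
    case (step x y)
    then have "(x, y) \<in> parcs (mk_symmetric ?H)" by simp
    then obtain e where e: "e \<in> words" "e \<in> S" "parent e \<in> S" "{x, y} = {parent e, e}"
      by (auto simp: parcs_mk_symmetric)
    from e(4) consider "x = parent e" "y = e" | "x = e" "y = parent e"
      by (auto simp: doubleton_eq_iff)
    then show ?case
    proof cases
      case 1
      show ?thesis using step.IH arc[OF e(1-3)] unfolding 1 by (rule iffD2[rotated])
    next
      case 2
      show ?thesis using step.IH arc[OF e(1-3)] unfolding 2 by (rule iffD1[rotated])
    qed
  qed
  with b show False by blast
qed

text \<open>
  Two vertices \<open>a\<close> and \<open>b\<close> below different children of the root are joined through the root and
  through every ancestor of \<open>a\<close>.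
\<close>

lemma subtree_through:
  assumes S: "subtree path_graph S" and w: "w \<in> words"
    and a: "a \<in> S" "a = w @ u" and b: "b \<in> S" "take N b \<noteq> take N w"
  shows "w \<in> S \<and> parent w \<in> S \<and> [] \<in> S"
proof -
  have "N \<le> length w" using w by (rule words_length)
  then have "\<nexists>u. b = w @ u" "\<nexists>u. b = take N w @ u" using b(2) by auto
  moreover have "take N w \<in> words" using w words_take[of "take N w" "drop N w"] \<open>N \<le> length w\<close> by simp
  moreover have "a = take N w @ drop N w @ u" using a(2) by (simp flip: append_assoc)
  moreover have "parent (take N w) = []" by (simp add: parent_def)
  ultimately show ?thesis using subtree_crossing[OF S] w a b(1) by metis
qed

lemma complete_subtree_root_leaf:
  assumes S: "complete_subtree path_graph [] S" and leaf: "[] \<in> leaves path_graph S"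
  shows "S = {[]}"
proof (rule ccontr)
  assume "S \<noteq> {[]}"
  moreover have "[] \<in> S" "S \<subseteq> insert [] words" "subtree path_graph S"
    using S by (auto simp: complete_subtree_def subtree_def)
  ultimately obtain w where w: "w \<in> S" "w \<in> words" by blast
  let ?c = "take N w"
  have c: "?c \<in> words" "length ?c = N"
    using words_take[of ?c "drop N w"] w words_length[of w] by simp_all
  have "\<nexists>u. [] = ?c @ u" using c N_pos by auto
  then have "?c \<in> S"
    using subtree_crossing[OF \<open>subtree path_graph S\<close> c(1) w(1) _ \<open>[] \<in> S\<close>]
    by (metis append_take_drop_id)
  moreover have "?c \<in> children path_graph []" using c by (simp add: children_Nil)
  ultimately show False using leaf by (auto simp: leaves_def)
qed

lemma next_word:
  assumes "w \<in> words" "w = v @ u" "u \<noteq> []" "v \<in> insert [] words"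
  obtains c u' where "c \<in> children path_graph v" "w = c @ u'" "length v < length c"
proof (cases "v = []")
  case True
  have Nw: "N \<le> length w" using assms(1) by (rule words_length)
  then have "take N w \<in> words" using words_take[of "take N w" "drop N w"] assms(1) by simp
  then have "take N w \<in> children path_graph []" using Nw by (simp add: children_Nil)
  then show ?thesis using that[of "take N w" "drop N w"] True Nw N_pos by auto
next
  case False
  then have v: "v \<in> words" using assms(4) by simp
  obtain e u' where u: "u = e # u'" using assms(3) by (cases u) auto
  then have "v @ [e] \<in> words"
    using words_take[of "v @ [e]" u'] assms(1,2) words_length[OF v] by simp
  then have "v @ [e] \<in> children path_graph v" using parent_snoc[OF v] by (simp add: children_path_graph)
  then show ?thesis using that[of "v @ [e]" u'] assms(2) u by simp
qed

text \<open>
  The longest prefix of \<open>w\<close> in \<open>S\<close> is a leaf: otherwise completeness would put its child in the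
  direction of \<open>w\<close> into \<open>S\<close> too.
\<close>

lemma long_words_in_complement_forest:
  assumes S: "complete_subtree path_graph [] S" and w: "w \<in> words"
    and long: "\<And>v. v \<in> S \<Longrightarrow> length v < length w"
  shows "w \<in> verts (complement_forest path_graph S)"
proof -
  have Sv: "S \<subseteq> insert [] words" "finite S" "[] \<in> S"
    using S by (auto simp: complete_subtree_def subtree_def)
  let ?A = "{v \<in> S. \<exists>u. w = v @ u}"
  have A: "finite (length ` ?A)" "length ` ?A \<noteq> {}" using Sv by auto
  obtain v where v: "v \<in> ?A" "length v = Max (length ` ?A)"
    using Max_in[OF A] by (metis (no_types, lifting) imageE)
  have v_max: "length v' \<le> length v" if "v' \<in> ?A" for v'
    unfolding v(2) using A(1) that by (intro Max_ge imageI)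
  obtain u where u: "w = v @ u" using v(1) by blast
  have "v \<in> leaves path_graph S"
  proof (rule ccontr)
    assume "v \<notin> leaves path_graph S"
    then have ch: "children path_graph v \<subseteq> S" using S v(1) by (auto simp: complete_subtree_def leaves_def)
    have "u \<noteq> []" using long[of v] v(1) u by auto
    then obtain c u' where "c \<in> children path_graph v" "w = c @ u'" "length v < length c"
      using next_word[OF w u] v(1) Sv by blast
    then show False using v_max[of c] ch by auto
  qed
  then show ?thesis using u w verts_complement_forest[OF Sv(1)] by auto
qed

lemma walk_in_words:
  assumes "w \<in> words" "awalk (target w) p v"
  shows "w @ p \<in> words \<and> target (w @ p) = v"
  using assms
proof (induction p arbitrary: w)
  case Nil
  then show ?case by (simp add: awalk_Nil_iff)
next
  case (Cons e p)
  then have "w @ [e] \<in> words" "awalk (target (w @ [e])) p v"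
    by (auto simp: awalk_Cons_iff snoc_in_words_iff target_def)
  from Cons.IH[OF this] show ?case by simp
qed

text \<open>
  Below every word there are words ending at any given vertex of the graph. As the root has two
  children, every vertex of the tree lies between two such words.
\<close>

lemma colouring_structure_path_graph: "colouring_structure path_graph [] path_colouring"
proof -
  have V: "verts path_graph - {[]} = words" using Nil_notin_words by auto
  have ends_at: "\<exists>u. w @ u \<in> words \<and> target (w @ u) = l" if "w \<in> words" "l \<in> verts G" for w l
    using that diconnected_walk[OF target_in_verts] walk_in_words by metis
  have full: "S = verts path_graph"
    if S: "subtree path_graph S" and l: "l \<in> verts G" "{v \<in> words. target v = l} \<subseteq> S" for S l
  proof -
    have "w \<in> S \<and> [] \<in> S" if w: "w \<in> words" for w
    proof -
      obtain u where "w @ u \<in> S" using ends_at[OF w l(1)] l(2) by blast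
      moreover obtain x where x: "x \<in> Y" "prefix N x \<noteq> take N w" using two_prefixes by metis
      moreover obtain u' where "prefix N x @ u' \<in> S"
        using ends_at[OF prefix_in_words[OF x(1)] l(1)] l(2) by blast
      ultimately show ?thesis using subtree_through[OF S w, of "w @ u" u "prefix N x @ u'"] by simp
    qed
    moreover have "words \<noteq> {}" using two_prefixes prefix_in_words by blast
    ultimately show ?thesis using S by (auto simp: subtree_def)
  qed
  have bij: "bij_betw last {w \<in> words. parent w = v \<and> target w = l} {e \<in> arcs G. tail G e = target v \<and> head G e = l}"
    if v: "v \<in> words" for v l
  proof -
    have eq: "{w \<in> words. parent w = v} = (\<lambda>e. v @ [e]) ` {e \<in> arcs G. tail G e = target v}"
      using children_word[OF v] by (auto simp: children_path_graph)
    have "{w \<in> words. parent w = v \<and> target w = l} =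
        (\<lambda>e. v @ [e]) ` {e \<in> arcs G. tail G e = target v \<and> head G e = l}"
    proof -
      have "{w \<in> words. parent w = v \<and> target w = l} = {w \<in> {w \<in> words. parent w = v}. target w = l}" by blast
      also have "\<dots> = (\<lambda>e. v @ [e]) ` {e \<in> arcs G. tail G e = target v \<and> head G e = l}"
        unfolding eq by (auto simp: target_def)
      finally show ?thesis .
    qed
    then show ?thesis by (auto simp: bij_betw_def inj_on_def image_image)
  qed
  have relabel: "\<exists>f. bij_betw f (children path_graph v) (children path_graph w) \<and>
      (\<forall>u\<in>children path_graph v. target (f u) = target u)"
    if v: "v \<in> words" and w: "w \<in> words" and eq: "target v = target w" for v w
  proof (intro exI conjI ballI)
    have "(\<lambda>u. w @ [last u]) ` children path_graph v = children path_graph w"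
      using eq by (force simp: children_word[OF v] children_word[OF w])
    moreover have "inj_on (\<lambda>u. w @ [last u]) (children path_graph v)"
      by (auto simp: children_word[OF v] inj_on_def)
    ultimately show "bij_betw (\<lambda>u. w @ [last u]) (children path_graph v) (children path_graph w)"
      by (simp add: bij_betw_def)
    show "target (w @ [last u]) = target u" for u by (simp add: target_def)
  qed
  have count: "card {e \<in> arcs G. tail G e = target v \<and> head G e = l} =
      card {w \<in> children path_graph v. target w = l}" if "v \<in> words" for v l
    using bij_betw_same_card[OF bij[OF that, of l]] by (simp add: children_path_graph conj_assoc)
  have last_arc: "last w \<in> arcs G" if "w \<in> words" "parent w \<noteq> []" for w
  proof -
    have "parent w \<in> words" using parent_in_verts[OF that(1)] that(2) by blast
    then have "w \<in> children path_graph (parent w)" using that by (simp add: children_path_graph)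
    then obtain e where "w = parent w @ [e]" "e \<in> arcs G"
      unfolding children_word[OF \<open>parent w \<in> words\<close>] by blast
    then show ?thesis by (metis last_snoc)
  qed
  show ?thesis
    unfolding colouring_structure_def V
  proof (intro conjI ballI impI)
    show "finite (labels path_colouring)" by (simp add: path_colouring_def)
    show "lab path_colouring \<in> words \<rightarrow> labels path_colouring"
      using target_in_verts by (simp add: path_colouring_def)
    show "\<exists>f. bij_betw f (children path_graph v) (children path_graph w) \<and>
        (\<forall>u\<in>children path_graph v. lab path_colouring (f u) = lab path_colouring u)"
      if "v \<in> words" "w \<in> words" "lab path_colouring v = lab path_colouring w" for v w
      using relabel that by (simp add: path_colouring_def)
    show "\<nexists>S. subtree path_graph S \<and> S \<noteq> verts path_graph \<and> {v \<in> words. lab path_colouring v = l} \<subseteq> S"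
      if "l \<in> labels path_colouring" for l
      using full that by (auto simp: path_colouring_def)
    show "finite (colours path_colouring l l')" for l l' by (simp add: path_colouring_def)
    show "disjoint_family_on (\<lambda>(l, l'). colours path_colouring l l')
        (labels path_colouring \<times> labels path_colouring)"
      by (auto simp: path_colouring_def disjoint_family_on_def)
    show "card (colours path_colouring (lab path_colouring v) l') =
        card {u \<in> children path_graph v. lab path_colouring u = l'}" if "v \<in> words" for v l'
      using count[OF that] by (simp add: path_colouring_def)
    show "ccol path_colouring \<in> arcs path_graph - out_arcs path_graph [] \<rightarrow>
        (\<Union>l\<in>labels path_colouring. \<Union>l'\<in>labels path_colouring. colours path_colouring l l')"
      using last_arc by (auto simp: path_colouring_def)
    show "bij_betw (ccol path_colouring)
        {e \<in> out_arcs path_graph v. lab path_colouring (head path_graph e) = l'}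
        (colours path_colouring (lab path_colouring v) l')" if "v \<in> words" for v l'
      using bij[OF that] by (simp add: path_colouring_def conj_assoc)
  qed
qed

end

context path_tree begin

section \<open>Complete subtrees and cylinder partitions\<close>

text \<open>
  Sets of words whose cylinders partition \<open>Y\<close>. They are the leaf sets of the complete subtrees used
  below; passing from a subtree to its leaves turns statements about subtrees into ones about
  points of \<open>Y\<close>.
\<close>

definition cylinder_partition :: "'e list set \<Rightarrow> bool" where
  "cylinder_partition P \<longleftrightarrow>
     finite P \<and> P \<subseteq> words \<and> (\<forall>x\<in>Y. \<exists>!p. p \<in> P \<and> prefix (length p) x = p)"

definition tree_above :: "'e list set \<Rightarrow> 'e list set" where
  "tree_above P = {v \<in> insert [] words. \<exists>p\<in>P. \<exists>u. p = v @ u}"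

lemma prefixes_comparable:
  assumes "prefix m x = a" "prefix n x = b" "m \<le> n"
  shows "\<exists>u. b = a @ u"
proof -
  obtain j where "n = m + j" using assms(3) le_Suc_ex by blast
  then have "b = prefix m x @ prefix j (suffix m x)" by (simp only: assms(2)[symmetric] prefix_add)
  then show ?thesis by (simp only: assms(1)) blast
qed

lemma cylinder_partition_antichain:
  assumes P: "cylinder_partition P" and p: "p \<in> P" "p @ u \<in> P"
  shows "u = []"
proof -
  have "p @ u \<in> words" using P p by (auto simp: cylinder_partition_def)
  then obtain x where x: "x \<in> Y" "prefix (length (p @ u)) x = p @ u" by (rule wordsE)
  have "prefix (length p) x @ prefix (length u) (suffix (length p) x) = p @ u"
    using x(2) by (simp only: length_append prefix_add)
  then have "prefix (length p) x = p" by simp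
  with P p x have "p = p @ u" unfolding cylinder_partition_def by blast
  then show ?thesis by simp
qed

lemma cylinder_partition_comparable:
  assumes P: "cylinder_partition P" and w: "w \<in> words"
  obtains p u where "p \<in> P" "w = p @ u" | p u where "p \<in> P" "p = w @ u"
proof -
  obtain x where x: "x \<in> Y" "prefix (length w) x = w" using w by (rule wordsE)
  then obtain p where p: "p \<in> P" "prefix (length p) x = p"
    using P unfolding cylinder_partition_def by blast
  show ?thesis
    using prefixes_comparable[OF p(2) x(2)] prefixes_comparable[OF x(2) p(2)] p(1) that
    by (cases "length p \<le> length w") auto
qed

lemma cylinder_partition_nonempty: "cylinder_partition P \<Longrightarrow> P \<noteq> {}"
  using two_prefixes by (auto simp: cylinder_partition_def)

text \<open>
  A child of a proper prefix of some \<open>p \<in> P\<close> is comparable with an element of \<open>P\<close>. It cannot strictly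
  extend one, since then two elements of \<open>P\<close> would be comparable, so it lies in the tree.
\<close>

lemma tree_above_children:
  assumes P: "cylinder_partition P" and v: "v \<in> tree_above P"
  shows "if v \<in> P then children path_graph v \<inter> tree_above P = {}
    else children path_graph v \<noteq> {} \<and> children path_graph v \<subseteq> tree_above P"
proof (cases "v \<in> P")
  case True
  have vw: "v \<in> words" using True P by (auto simp: cylinder_partition_def)
  have "w \<notin> tree_above P" if "w \<in> children path_graph v" for w
  proof
    assume "w \<in> tree_above P"
    moreover obtain e where "w = v @ [e]" using \<open>w \<in> children path_graph v\<close> children_word[OF vw] by auto
    ultimately obtain u where "v @ (e # u) \<in> P" by (auto simp: tree_above_def)
    then show False using cylinder_partition_antichain[OF P True] by blast
  qed
  with True show ?thesis by auto
next
  case False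
  from v obtain p u where p: "p \<in> P" "p = v @ u" and vV: "v \<in> insert [] words"
    by (auto simp: tree_above_def)
  with False have "u \<noteq> []" by auto
  have "p \<in> words" using p P by (auto simp: cylinder_partition_def)
  then have ne: "children path_graph v \<noteq> {}" using next_word[OF _ p(2) \<open>u \<noteq> []\<close> vV] by blast
  have "w \<in> tree_above P" if "w \<in> children path_graph v" for w
  proof -
    have w: "w \<in> words" "parent w = v" using that by (auto simp: children_path_graph)
    from P w(1) show ?thesis
    proof (cases rule: cylinder_partition_comparable)
      case (1 q u')
      have "u' = []"
      proof (rule ccontr)
        assume "u' \<noteq> []"
        have "q \<in> words" using 1(1) P by (auto simp: cylinder_partition_def)
        then have "v = q @ butlast u'"
          using w(2) 1(2) \<open>u' \<noteq> []\<close> words_length[of q]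
          by (cases u' rule: rev_cases) (auto simp: parent_def butlast_append)
        then have "p = q @ (butlast u' @ u)" using p(2) by simp
        then have "butlast u' @ u = []" using cylinder_partition_antichain[OF P 1(1)] p(1) by blast
        with \<open>u \<noteq> []\<close> show False by simp
      qed
      then show ?thesis using 1 w(1) by (auto simp: tree_above_def)
    next
      case (2 q u')
      then show ?thesis using w(1) by (auto simp: tree_above_def)
    qed
  qed
  with ne False show ?thesis by auto
qed

lemma tree_above_parent:
  assumes "v \<in> tree_above P" "v \<noteq> []"
  shows "parent v \<in> tree_above P"
proof -
  have v: "v \<in> words" using assms by (auto simp: tree_above_def)
  obtain p u where p: "p \<in> P" "p = v @ u" using assms by (auto simp: tree_above_def)
  have "v = parent v @ drop (length (parent v)) v"
    by (cases v rule: rev_cases) (auto simp: parent_def)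
  then have "p = parent v @ (drop (length (parent v)) v @ u)" using p(2) by (metis append_assoc)
  then show ?thesis using p(1) parent_in_verts[OF v] unfolding tree_above_def by blast
qed

lemma tree_above_subtree:
  assumes P: "P \<noteq> {}"
  shows "subtree path_graph (tree_above P)"
proof -
  let ?H = "path_graph \<restriction> tree_above P"
  have root: "[] \<in> tree_above P" using P by (auto simp: tree_above_def)
  interpret H: wf_digraph ?H by unfold_locales auto
  interpret M: pair_wf_digraph "mk_symmetric ?H" by (rule H.wellformed_mk_symmetric)
  have reach: "[] \<rightarrow>\<^sup>*\<^bsub>?H\<^esub> v" if "v \<in> tree_above P" for v
    using that
  proof (induction "length v" arbitrary: v rule: less_induct)
    case less
    show ?case
    proof (cases "v = []")
      case True
      then show ?thesis using root by (simp add: H.reachable_refl)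
    next
      case False
      then have v: "v \<in> words" using less.prems by (auto simp: tree_above_def)
      have par: "parent v \<in> tree_above P" using less.prems False by (rule tree_above_parent)
      have "parent v \<rightarrow>\<^bsub>?H\<^esub> v"
        using v par less.prems by (intro H.dominatesI[of v]) (auto simp: arc_to_ends_def)
      with less.hyps[OF parent_short[OF v] par] show ?thesis by (rule H.reachable_adj_trans)
    qed
  qed
  have "u \<rightarrow>\<^sup>*\<^bsub>mk_symmetric ?H\<^esub> v" if "u \<in> tree_above P" "v \<in> tree_above P" for u v
  proof -
    have "[] \<rightarrow>\<^sup>*\<^bsub>mk_symmetric ?H\<^esub> u" "[] \<rightarrow>\<^sup>*\<^bsub>mk_symmetric ?H\<^esub> v"
      using reach that H.reachable_mk_symmetricI by blast+
    moreover from this(1) have "u \<rightarrow>\<^sup>*\<^bsub>mk_symmetric ?H\<^esub> []"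
      by (rule symmetric_reachable[OF symmetric_mk_symmetric])
    ultimately show ?thesis by (metis M.reachable_trans)
  qed
  moreover have "tree_above P \<subseteq> insert [] words" by (auto simp: tree_above_def)
  ultimately show ?thesis
    using root by (auto simp: subtree_def connected_def strongly_connected_def)
qed

lemma complete_subtree_tree_above:
  assumes P: "cylinder_partition P"
  shows "complete_subtree path_graph [] (tree_above P)"
  unfolding complete_subtree_def
proof (intro conjI ballI)
  have ne: "P \<noteq> {}" using P by (rule cylinder_partition_nonempty)
  have "finite P" using P by (simp add: cylinder_partition_def)
  then have "finite (\<Union>p\<in>P. (\<lambda>n. take n p) ` {..length p})" by blast
  moreover have "tree_above P \<subseteq> (\<Union>p\<in>P. (\<lambda>n. take n p) ` {..length p})"
  proof
    fix v assume "v \<in> tree_above P"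
    then obtain p u where "p \<in> P" "p = v @ u" by (auto simp: tree_above_def)
    then show "v \<in> (\<Union>p\<in>P. (\<lambda>n. take n p) ` {..length p})"
      by (intro UN_I[of p] image_eqI[of _ _ "length v"]) auto
  qed
  ultimately show "finite (tree_above P)" by (rule rev_finite_subset)
  show "subtree path_graph (tree_above P)" using ne by (rule tree_above_subtree)
  show "[] \<in> tree_above P" using ne by (auto simp: tree_above_def)
  show "children path_graph v \<subseteq> tree_above P \<or> children path_graph v \<inter> tree_above P = {}"
    if "v \<in> tree_above P" for v
    using tree_above_children[OF P that] by (auto split: if_splits)
qed

lemma leaves_tree_above:
  assumes P: "cylinder_partition P"
  shows "leaves path_graph (tree_above P) = P"
proof (intro subset_antisym subsetI)
  fix v assume "v \<in> leaves path_graph (tree_above P)"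
  then show "v \<in> P"
    using tree_above_children[OF P, of v] by (auto simp: leaves_def split: if_splits)
next
  fix v assume v: "v \<in> P"
  then have "v \<in> tree_above P" using P by (auto simp: tree_above_def cylinder_partition_def)
  then show "v \<in> leaves path_graph (tree_above P)"
    using tree_above_children[OF P, of v] v by (auto simp: leaves_def)
qed

lemma verts_complement_tree_above:
  assumes P: "cylinder_partition P"
  shows "verts (complement_forest path_graph (tree_above P)) = {w \<in> words. \<exists>p\<in>P. \<exists>u. w = p @ u}"
proof -
  have "tree_above P \<subseteq> insert [] words" by (auto simp: tree_above_def)
  moreover have "[] \<notin> P" using P by (auto simp: cylinder_partition_def)
  ultimately show ?thesis by (subst verts_complement_forest) (auto simp: leaves_tree_above[OF P])
qed

lemma tree_above_not_root:
  assumes P: "cylinder_partition P"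
  shows "tree_above P \<noteq> {[]}"
proof -
  obtain p where p: "p \<in> P" using cylinder_partition_nonempty[OF P] by blast
  then have "p \<in> words" using P by (auto simp: cylinder_partition_def)
  with p have "p \<in> tree_above P" "p \<noteq> []" by (auto simp: tree_above_def)
  then show ?thesis by blast
qed

lemma cylinder_partition_of_length:
  assumes "N \<le> n"
  shows "cylinder_partition {w \<in> words. length w = n}"
  unfolding cylinder_partition_def
proof (intro conjI ballI)
  have "{w \<in> words. length w = n} \<subseteq> {w \<in> words. length w \<le> n}" by auto
  then show "finite {w \<in> words. length w = n}" using words_of_length_finite finite_subset by blast
  show "\<exists>!p. p \<in> {w \<in> words. length w = n} \<and> prefix (length p) x = p" if "x \<in> Y" for x
    using prefix_in_words[OF that assms] by (intro ex1I[of _ "prefix n x"]) auto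
qed auto

lemma tree_above_long:
  assumes "S \<subseteq> insert [] words" "\<And>v. v \<in> S \<Longrightarrow> length v \<le> n" "N \<le> n"
  shows "S \<subseteq> tree_above {w \<in> words. length w = n}"
proof
  fix v assume v: "v \<in> S"
  have "\<exists>u. v @ u \<in> {w \<in> words. length w = n}"
  proof (cases "v = []")
    case True
    obtain x where "x \<in> Y" using two_prefixes by blast
    then show ?thesis
      using True prefix_in_words[OF _ assms(3)] by (intro exI[of _ "prefix n x"]) auto
  next
    case False
    then obtain x where x: "x \<in> Y" "prefix (length v) x = v" using v assms(1) by (blast elim: wordsE)
    then obtain u where "prefix n x = v @ u"
      using prefixes_comparable[OF x(2) refl assms(2)[OF v]] by blast
    then show ?thesis using prefix_in_words[OF x(1) assms(3)] by (intro exI[of _ u]) (metis (mono_tags, lifting) diff_zero mem_Collect_eq subsequence_length)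
  qed
  then show "v \<in> tree_above {w \<in> words. length w = n}" using v assms(1) unfolding tree_above_def by blast
qed

end

context path_tree begin

section \<open>Almost automorphisms and the maps they induce on infinite paths\<close>

abbreviation forest_below :: "'e list set \<Rightarrow> ('e list, 'e list) pre_digraph" where
  "forest_below S \<equiv> complement_forest path_graph S"

abbreviation honest :: "('e list, 'e list) tree_map \<Rightarrow> bool" where
  "honest \<equiv> honest_almost_automorphism path_graph []"

text \<open>
  The map on ends and the preservation of colours are captured together: the almost automorphism
  maps all long prefixes of \<open>x\<close> to prefixes of \<open>f x\<close> and keeps the tails. Only the values on long
  words enter, so the condition is invariant under almost equality.
\<close>

definition induces :: "('e list, 'e list) tree_map \<Rightarrow> ((nat \<Rightarrow> 'e) \<Rightarrow> nat \<Rightarrow> 'e) \<Rightarrow> bool" where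
  "induces \<phi> f \<longleftrightarrow>
     (\<exists>K\<ge>N. \<forall>n\<ge>K. \<forall>x\<in>Y. f x = vmap \<phi> (prefix n x) \<frown> suffix n x)"

definition induced_class :: "((nat \<Rightarrow> 'e) \<Rightarrow> nat \<Rightarrow> 'e) \<Rightarrow> ('e list, 'e list) tree_map set" where
  "induced_class f = {\<phi>. honest \<phi> \<and> induces \<phi> f}"

lemma honest_iff:
  "honest \<phi> \<longleftrightarrow>
     complete_subtree path_graph [] (dom_tree \<phi>) \<and> complete_subtree path_graph [] (cod_tree \<phi>) \<and>
     bij_betw (vmap \<phi>) (verts (forest_below (dom_tree \<phi>))) (verts (forest_below (cod_tree \<phi>))) \<and>
     bij_betw (emap \<phi>) (arcs (forest_below (dom_tree \<phi>))) (arcs (forest_below (cod_tree \<phi>))) \<and>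
     (\<forall>e\<in>arcs (forest_below (dom_tree \<phi>)).
        parent (emap \<phi> e) = vmap \<phi> (parent e) \<and> emap \<phi> e = vmap \<phi> e)"
  by (simp add: honest_almost_automorphism_def Let_def)

lemma complete_subtree_verts: "complete_subtree path_graph [] S \<Longrightarrow> S \<subseteq> insert [] words"
  by (simp add: complete_subtree_def subtree_def)

lemma complete_subtree_deep:
  assumes S: "complete_subtree path_graph [] S"
  obtains K where "N \<le> K" "\<And>v. v \<in> S \<Longrightarrow> length v < K"
    "\<And>w. w \<in> words \<Longrightarrow> K \<le> length w \<Longrightarrow> w \<in> verts (forest_below S)"
proof -
  have fin: "finite (length ` S)" using S by (simp add: complete_subtree_def)
  define K where "K = max N (Suc (Max (length ` S)))"
  have len: "length v < K" if "v \<in> S" for v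
    using Max_ge[OF fin imageI[OF that]] by (simp add: K_def)
  show ?thesis
  proof (rule that[of K])
    show "w \<in> verts (forest_below S)" if "w \<in> words" "K \<le> length w" for w
      using long_words_in_complement_forest[OF S that(1)] len that(2) by (meson less_le_trans)
  qed (auto simp: K_def len[unfolded K_def])
qed

lemma forest_below_extend:
  assumes "S \<subseteq> insert [] words" "w \<in> verts (forest_below S)" "w @ u \<in> words"
  shows "w @ u \<in> verts (forest_below S)"
  using assms by (force simp: verts_complement_forest)

lemma forest_below_snoc_arc:
  assumes "S \<subseteq> insert [] words" "w \<in> verts (forest_below S)" "w \<in> words" "w @ [e] \<in> words"
  shows "w @ [e] \<in> arcs (forest_below S)"
  using forest_below_extend[OF assms(1,2,4)] assms
  by (simp add: arcs_complement_forest parent_snoc)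

lemma honest_vmap_snoc:
  assumes \<phi>: "honest \<phi>" and w: "w \<in> verts (forest_below (dom_tree \<phi>))" "w \<in> words" "w @ [e] \<in> words"
  shows "vmap \<phi> (w @ [e]) \<in> words" "parent (vmap \<phi> (w @ [e])) = vmap \<phi> w"
    "emap \<phi> (w @ [e]) = vmap \<phi> (w @ [e])"
proof -
  have "w @ [e] \<in> arcs (forest_below (dom_tree \<phi>))"
    using \<phi> w by (intro forest_below_snoc_arc complete_subtree_verts) (simp_all add: honest_iff)
  moreover from this have "emap \<phi> (w @ [e]) \<in> arcs (forest_below (cod_tree \<phi>))"
    using \<phi> by (auto simp: honest_iff bij_betw_def)
  ultimately show "vmap \<phi> (w @ [e]) \<in> words" "parent (vmap \<phi> (w @ [e])) = vmap \<phi> w"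
    "emap \<phi> (w @ [e]) = vmap \<phi> (w @ [e])"
    using \<phi> w parent_snoc[OF w(2), of e] by (auto simp: honest_iff arcs_complement_forest)
qed

text \<open>
  An honest almost automorphism maps arcs to arcs, so it lengthens the images of the prefixes of a
  path by at least one letter in each step.
\<close>

lemma honest_vmap_length:
  assumes \<phi>: "honest \<phi>" and K: "N \<le> K"
    "\<And>w. w \<in> words \<Longrightarrow> K \<le> length w \<Longrightarrow> w \<in> verts (forest_below (dom_tree \<phi>))"
    and x: "x \<in> Y"
  shows "j \<le> length (vmap \<phi> (prefix (K + j) x))"
proof (induction j)
  case (Suc j)
  let ?w = "prefix (K + j) x"
  have eq: "prefix (K + Suc j) x = ?w @ [x (K + j)]" by simp
  have w: "?w \<in> words" "?w @ [x (K + j)] \<in> words"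
    using prefix_in_words[OF x, of "K + j"] prefix_in_words[OF x, of "K + Suc j"] K(1) by simp_all
  have "?w \<in> verts (forest_below (dom_tree \<phi>))" using K(2)[OF w(1)] by simp
  from honest_vmap_snoc[OF \<phi> this w] parent_short
  have "length (vmap \<phi> ?w) < length (vmap \<phi> (?w @ [x (K + j)]))" by metis
  then show ?case using Suc.IH unfolding eq by linarith
qed simp

lemma honest_comp:
  assumes \<phi>: "honest \<phi>" and \<psi>: "honest \<psi>" and eq: "cod_tree \<psi> = dom_tree \<phi>"
  shows "honest (tree_map_comp \<phi> \<psi>)"
proof -
  have "parent (vmap \<phi> (vmap \<psi> e)) = vmap \<phi> (vmap \<psi> (parent e)) \<and>
      emap \<phi> (emap \<psi> e) = vmap \<phi> (vmap \<psi> e)"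
    if e: "e \<in> arcs (forest_below (dom_tree \<psi>))" for e
  proof -
    have "emap \<psi> e \<in> arcs (forest_below (dom_tree \<phi>))"
      using \<psi> e by (auto simp: honest_iff eq bij_betw_def)
    then show ?thesis using \<phi> \<psi> e by (metis honest_iff)
  qed
  then show ?thesis
    using \<phi> \<psi> by (auto simp: honest_iff tree_map_comp_def eq intro: bij_betw_trans)
qed

text \<open>
  The image under \<open>\<psi>\<close> of a long prefix of \<open>x\<close> is a prefix of \<open>g x\<close>, and it is long enough for
  \<open>\<phi>\<close> to act on it as \<open>f\<close> does.
\<close>

lemma induces_comp:
  assumes \<phi>: "honest \<phi>" "induces \<phi> f" and \<psi>: "honest \<psi>" "induces \<psi> g"
    and eq: "cod_tree \<psi> = dom_tree \<phi>" and gY: "\<And>x. x \<in> Y \<Longrightarrow> g x \<in> Y"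
    and fg: "\<And>x. x \<in> Y \<Longrightarrow> h x = f (g x)"
  shows "induces (tree_map_comp \<phi> \<psi>) h"
proof -
  obtain Kf where Kf: "\<And>n x. Kf \<le> n \<Longrightarrow> x \<in> Y \<Longrightarrow> f x = vmap \<phi> (prefix n x) \<frown> suffix n x"
    using \<phi>(2) unfolding induces_def by blast
  obtain Kg where Kg: "\<And>n x. Kg \<le> n \<Longrightarrow> x \<in> Y \<Longrightarrow> g x = vmap \<psi> (prefix n x) \<frown> suffix n x"
    using \<psi>(2) unfolding induces_def by blast
  have "complete_subtree path_graph [] (dom_tree \<psi>)" using \<psi>(1) by (simp add: honest_iff)
  then obtain K where K: "N \<le> K"
      "\<And>w. w \<in> words \<Longrightarrow> K \<le> length w \<Longrightarrow> w \<in> verts (forest_below (dom_tree \<psi>))"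
    by (rule complete_subtree_deep) blast
  have "h x = vmap (tree_map_comp \<phi> \<psi>) (prefix n x) \<frown> suffix n x"
    if n: "K + Kf + Kg \<le> n" and x: "x \<in> Y" for n x
  proof -
    let ?b = "vmap \<psi> (prefix n x)"
    have g: "g x = ?b \<frown> suffix n x" using Kg n x by simp
    have "n = K + (n - K)" using n by simp
    then have "n - K \<le> length ?b" using honest_vmap_length[OF \<psi>(1) K x, of "n - K"] by simp
    then have "Kf \<le> length ?b" using n by linarith
    then have "f (g x) = vmap \<phi> (prefix (length ?b) (g x)) \<frown> suffix (length ?b) (g x)"
      using Kf gY[OF x] by blast
    then show ?thesis using fg[OF x] by (simp add: g tree_map_comp_def)
  qed
  then show ?thesis using K(1) unfolding induces_def by (intro exI[of _ "K + Kf + Kg"]) auto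
qed

text \<open>
  Almost automorphisms inducing the same map agree on all long words \<open>w\<close>, because the continuations
  of \<open>w\<close> determine the image of \<open>w\<close>.
\<close>

lemma induces_same_imp_almost_equal:
  assumes \<phi>: "honest \<phi>" "induces \<phi> f" and \<psi>: "honest \<psi>" "induces \<psi> f"
  shows "(\<phi>, \<psi>) \<in> almost_equal path_graph []"
proof -
  obtain K1 where K1: "\<And>n x. K1 \<le> n \<Longrightarrow> x \<in> Y \<Longrightarrow> f x = vmap \<phi> (prefix n x) \<frown> suffix n x"
    using \<phi>(2) unfolding induces_def by blast
  obtain K2 where K2: "\<And>n x. K2 \<le> n \<Longrightarrow> x \<in> Y \<Longrightarrow> f x = vmap \<psi> (prefix n x) \<frown> suffix n x"
    using \<psi>(2) unfolding induces_def by blast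
  have dom: "complete_subtree path_graph [] (dom_tree \<phi>)" "complete_subtree path_graph [] (dom_tree \<psi>)"
    using \<phi> \<psi> by (simp_all add: honest_iff)
  obtain K3 where K3: "N \<le> K3" "\<And>v. v \<in> dom_tree \<phi> \<Longrightarrow> length v < K3"
      "\<And>w. w \<in> words \<Longrightarrow> K3 \<le> length w \<Longrightarrow> w \<in> verts (forest_below (dom_tree \<phi>))"
    using complete_subtree_deep[OF dom(1)] by blast
  obtain K4 where K4: "N \<le> K4" "\<And>v. v \<in> dom_tree \<psi> \<Longrightarrow> length v < K4"
      "\<And>w. w \<in> words \<Longrightarrow> K4 \<le> length w \<Longrightarrow> w \<in> verts (forest_below (dom_tree \<psi>))"
    using complete_subtree_deep[OF dom(2)] by blast
  define K where "K = K1 + K2 + K3 + K4"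
  have "N \<le> K" using K3(1) by (simp add: K_def)
  let ?P = "{w \<in> words. length w = K}"
  have part: "cylinder_partition ?P" using \<open>N \<le> K\<close> by (rule cylinder_partition_of_length)
  have same: "vmap \<phi> w = vmap \<psi> w" if w: "w \<in> words" "K \<le> length w" for w
  proof (rule prefixing_determines_word[OF target_in_verts[OF w(1)]])
    fix z assume z: "z \<in> shift_space G" "tail G (z 0) = target w"
    have "w \<frown> z \<in> Y" using conc_in_Y[OF w(1) z] .
    then show "vmap \<phi> w \<frown> z = vmap \<psi> w \<frown> z"
      using K1[of "length w" "w \<frown> z"] K2[of "length w" "w \<frown> z"] w(2) by (simp add: K_def)
  qed
  have deep: "v \<in> words \<and> K \<le> length v" if "v \<in> verts (forest_below (tree_above ?P))" for v
    using that by (auto simp: verts_complement_tree_above[OF part])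
  show ?thesis
    unfolding almost_equal_def mem_Collect_eq prod.case
  proof (intro conjI exI[of _ "tree_above ?P"] ballI)
    show "complete_subtree path_graph [] (tree_above ?P)" using part by (rule complete_subtree_tree_above)
    show "dom_tree \<phi> \<union> dom_tree \<psi> \<subseteq> tree_above ?P"
      using complete_subtree_verts[OF dom(1)] complete_subtree_verts[OF dom(2)] K3(2) K4(2) \<open>N \<le> K\<close>
      by (intro tree_above_long) (fastforce simp: K_def)+
    show "vmap \<phi> v = vmap \<psi> v" if "v \<in> verts (forest_below (tree_above ?P))" for v
      using same deep[OF that] by blast
    show "emap \<phi> e = emap \<psi> e" if e: "e \<in> arcs (forest_below (tree_above ?P))" for e
    proof -
      have ends: "e \<in> words" "K \<le> length e" "parent e \<in> words" "K \<le> length (parent e)"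
        using e deep by (auto simp: arcs_complement_forest)
      then have "e \<in> arcs (forest_below (dom_tree \<phi>))" "e \<in> arcs (forest_below (dom_tree \<psi>))"
        using K3(3) K4(3) by (simp_all add: arcs_complement_forest K_def)
      then have "emap \<phi> e = vmap \<phi> e" "emap \<psi> e = vmap \<psi> e"
        using \<phi>(1) \<psi>(1) by (simp_all add: honest_iff)
      then show ?thesis using same ends by simp
    qed
  qed (use \<phi> \<psi> in auto)
qed

lemma almost_equal_sym: "(\<phi>, \<psi>) \<in> almost_equal T r \<Longrightarrow> (\<psi>, \<phi>) \<in> almost_equal T r"
  by (auto simp: almost_equal_def)

lemma induces_almost_equal:
  assumes eq: "(\<phi>, \<psi>) \<in> almost_equal path_graph []" and \<phi>: "induces \<phi> f"
  shows "honest \<psi>" "induces \<psi> f"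
proof -
  from eq obtain S where S: "complete_subtree path_graph [] S"
      and same: "\<forall>v\<in>verts (forest_below S). vmap \<phi> v = vmap \<psi> v"
    by (auto simp: almost_equal_def)
  show "honest \<psi>" using eq by (simp add: almost_equal_def)
  obtain K1 where K1: "\<And>n x. K1 \<le> n \<Longrightarrow> x \<in> Y \<Longrightarrow> f x = vmap \<phi> (prefix n x) \<frown> suffix n x"
    using \<phi> unfolding induces_def by blast
  obtain K where K: "N \<le> K" "\<And>w. w \<in> words \<Longrightarrow> K \<le> length w \<Longrightarrow> w \<in> verts (forest_below S)"
    using S by (rule complete_subtree_deep) blast
  have "f x = vmap \<psi> (prefix n x) \<frown> suffix n x" if n: "K + K1 \<le> n" and x: "x \<in> Y" for n x
  proof -
    have "prefix n x \<in> verts (forest_below S)" using K n prefix_in_words[OF x] by simp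
    then show ?thesis using K1[of n x] n x same by simp
  qed
  then show "induces \<psi> f" using K(1) unfolding induces_def by (intro exI[of _ "K + K1"]) auto
qed

lemma induced_class_eq:
  assumes "\<phi> \<in> induced_class f"
  shows "induced_class f = almost_equal path_graph [] `` {\<phi>}"
proof (intro subset_antisym subsetI)
  have \<phi>: "honest \<phi>" "induces \<phi> f" using assms by (simp_all add: induced_class_def)
  show "\<psi> \<in> almost_equal path_graph [] `` {\<phi>}" if "\<psi> \<in> induced_class f" for \<psi>
    using that induces_same_imp_almost_equal[OF \<phi>] by (simp add: induced_class_def)
  show "\<psi> \<in> induced_class f" if "\<psi> \<in> almost_equal path_graph [] `` {\<phi>}" for \<psi>
    using that induces_almost_equal[of \<phi> \<psi>] \<phi>(2) by (simp add: induced_class_def)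
qed

section \<open>Realising prefix exchanges by colour-preserving almost automorphisms\<close>

definition exchange_word :: "nat \<Rightarrow> ('e list \<Rightarrow> 'e list) \<Rightarrow> 'e list \<Rightarrow> 'e list" where
  "exchange_word K \<beta> w = \<beta> (take K w) @ drop K w"

lemma exchange_word_append:
  "K \<le> length w \<Longrightarrow> exchange_word K \<beta> (w @ u) = exchange_word K \<beta> w @ u"
  by (simp add: exchange_word_def)

lemma exchange_word_conc:
  assumes ex: "exchanges_prefixes Y N f K \<beta>" and wz: "w \<frown> z \<in> Y" and K: "K \<le> length w"
  shows "f (w \<frown> z) = exchange_word K \<beta> w \<frown> z" "N \<le> length (exchange_word K \<beta> w)"
proof -
  have "prefix K (w \<frown> z) = take K w" "suffix K (w \<frown> z) = drop K w \<frown> z" using K by simp_all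
  with ex wz have "N \<le> length (\<beta> (take K w)) \<and> f (w \<frown> z) = \<beta> (take K w) \<frown> drop K w \<frown> z"
    unfolding exchanges_prefixes_def by metis
  then show "f (w \<frown> z) = exchange_word K \<beta> w \<frown> z" "N \<le> length (exchange_word K \<beta> w)"
    by (simp_all add: exchange_word_def)
qed

context
  fixes f K \<beta>
  assumes fB: "f \<in> Bij Y" and NK: "N \<le> K" and ex: "exchanges_prefixes Y N f K \<beta>"
begin

abbreviation (input) E where "E \<equiv> exchange_word K \<beta>"

lemma exchange_word_in_words:
  assumes w: "w \<in> words" "K \<le> length w"
  shows "E w \<in> words" "target (E w) = target w"
proof -
  obtain z where z: "z \<in> shift_space G" "tail G (z 0) = target w" "w \<frown> z \<in> Y"
    using extension_in_Y[OF w(1)] .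
  have fz: "f (w \<frown> z) = E w \<frown> z" and len: "N \<le> length (E w)"
    using exchange_word_conc[OF ex z(3) w(2)] by simp_all
  have "f (w \<frown> z) \<in> Y" using fB z(3) by (auto simp: Bij_def bij_betw_def)
  then have Ez: "E w \<frown> z \<in> Y" by (simp only: fz)
  show "E w \<in> words" using prefix_in_words[OF Ez len] by simp
  show "target (E w) = target w" using suffix_start[OF Ez len] z(2) by simp
qed

text \<open>
  Words with equal images end at the same vertex, so they have a common continuation \<open>z\<close>, and
  injectivity of \<open>f\<close> makes them prefixes of the same point.
\<close>

lemma exchange_word_inj: "inj_on E {w \<in> words. K \<le> length w}"
proof -
  have wlog: "w = w'"
    if w: "w \<in> words" "K \<le> length w" and w': "w' \<in> words" "K \<le> length w'"
      and eq: "E w = E w'" and le: "length w \<le> length w'" for w w'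
  proof -
    obtain z where z: "z \<in> shift_space G" "tail G (z 0) = target w" "w \<frown> z \<in> Y"
      using extension_in_Y[OF w(1)] .
    have "target w = target w'"
      using exchange_word_in_words(2)[OF w] exchange_word_in_words(2)[OF w'] eq by simp
    then have z': "w' \<frown> z \<in> Y" using conc_in_Y[OF w'(1)] z by simp
    have "f (w \<frown> z) = f (w' \<frown> z)"
      using exchange_word_conc(1)[OF ex z(3) w(2)] exchange_word_conc(1)[OF ex z' w'(2)] eq by simp
    then have "w \<frown> z = w' \<frown> z"
      using fB z(3) z' by (auto simp: Bij_def bij_betw_def inj_on_def)
    then obtain t where t: "w' = w @ t" using le by (rule conc_eq_cases)
    then have "t = []" using eq w(2) by (simp add: exchange_word_append)
    with t show ?thesis by simp
  qed
  show ?thesis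
  proof (rule inj_onI)
    fix w w' assume "w \<in> {w \<in> words. K \<le> length w}" "w' \<in> {w \<in> words. K \<le> length w}" "E w = E w'"
    then show "w = w'"
      using wlog[of w w'] wlog[of w' w] by (cases "length w \<le> length w'") auto
  qed
qed

context
  fixes P
  assumes P: "cylinder_partition P" and long: "\<And>p. p \<in> P \<Longrightarrow> K \<le> length p"
begin

text \<open>
  A point \<open>f x\<close> has the prefix \<open>E p\<close> for the prefix \<open>p \<in> P\<close> of \<open>x\<close>. If \<open>E p\<^sub>2 = E p\<^sub>1 @ t\<close>, then
  \<open>p\<^sub>2 = p\<^sub>1 @ t\<close> by injectivity, so different elements of \<open>P\<close> have incomparable images.
\<close>

lemma cylinder_partition_exchange: "cylinder_partition (E ` P)"
  unfolding cylinder_partition_def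
proof (intro conjI ballI)
  have Pw: "p \<in> words" if "p \<in> P" for p using P that by (auto simp: cylinder_partition_def)
  show "finite (E ` P)" using P by (simp add: cylinder_partition_def)
  show "E ` P \<subseteq> words" using exchange_word_in_words(1) Pw long by blast
  fix y assume y: "y \<in> Y"
  then have "y \<in> f ` Y" using fB by (simp add: Bij_def bij_betw_def)
  then obtain x where x: "x \<in> Y" "f x = y" by blast
  then obtain p where p: "p \<in> P" "prefix (length p) x = p"
    using P unfolding cylinder_partition_def by blast
  have "p \<frown> suffix (length p) x = x" using prefix_suffix[of x "length p"] p(2) by simp
  then have "y = E p \<frown> suffix (length p) x"
    using exchange_word_conc(1)[OF ex, of p "suffix (length p) x"] long[OF p(1)] x by simp
  then have Ep: "prefix (length (E p)) y = E p" by simp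
  show "\<exists>!q. q \<in> E ` P \<and> prefix (length q) y = q"
  proof (rule ex1I[of _ "E p"])
    have key: "p1 = p2"
      if p1: "p1 \<in> P" "prefix (length (E p1)) y = E p1" and p2: "p2 \<in> P" "prefix (length (E p2)) y = E p2"
        and le: "length (E p1) \<le> length (E p2)" for p1 p2
    proof -
      obtain t where t: "E p2 = E p1 @ t" using prefixes_comparable[OF p1(2) p2(2) le] by blast
      note w1 = exchange_word_in_words[OF Pw[OF p1(1)] long[OF p1(1)]]
      have "p1 @ t \<in> words"
        using words_replace(1)[OF w1(1) Pw[OF p1(1)] w1(2), of t] t
          exchange_word_in_words(1)[OF Pw[OF p2(1)] long[OF p2(1)]] by simp
      moreover have "E (p1 @ t) = E p2" using t long[OF p1(1)] by (simp add: exchange_word_append)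
      ultimately have "p1 @ t = p2"
        using exchange_word_inj Pw[OF p2(1)] long[OF p1(1)] long[OF p2(1)]
        by (auto simp: inj_on_def)
      then show ?thesis using cylinder_partition_antichain[OF P p1(1)] p2(1) by auto
    qed
    show "q = E p" if q: "q \<in> E ` P \<and> prefix (length q) y = q" for q
    proof -
      obtain p' where "p' \<in> P" "q = E p'" using q by blast
      then show ?thesis using key[of p p'] key[of p' p] p(1) Ep q by (metis nat_le_linear)
    qed
  qed (use p Ep in blast)
qed

definition exchange_map :: "('e list, 'e list) tree_map" where
  "exchange_map = \<lparr>dom_tree = tree_above P, cod_tree = tree_above (E ` P), vmap = E, emap = E\<rparr>"

lemma exchange_map_honest: "honest exchange_map"
proof -
  note Q = cylinder_partition_exchange
  let ?F = "forest_below (tree_above P)" and ?F' = "forest_below (tree_above (E ` P))"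
  have F: "verts ?F = {w \<in> words. \<exists>p\<in>P. \<exists>u. w = p @ u}"
    using P by (rule verts_complement_tree_above)
  have F': "verts ?F' = {w \<in> words. \<exists>p\<in>E ` P. \<exists>u. w = p @ u}"
    using Q by (rule verts_complement_tree_above)
  have Pw: "p \<in> words" if "p \<in> P" for p using P that by (auto simp: cylinder_partition_def)
  have F_long: "w \<in> words \<and> K \<le> length w" if "w \<in> verts ?F" for w
    using that long unfolding F by fastforce
  have img: "E ` verts ?F = verts ?F'"
  proof (intro subset_antisym subsetI)
    fix v assume "v \<in> E ` verts ?F"
    then obtain w p u where w: "v = E w" "w \<in> words" "p \<in> P" "w = p @ u" unfolding F by blast
    moreover have "E w \<in> words" using w long[of p] by (intro exchange_word_in_words) auto
    ultimately show "v \<in> verts ?F'" unfolding F' using long[of p] by (auto simp: exchange_word_append)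
  next
    fix v assume "v \<in> verts ?F'"
    then obtain p u where v: "v \<in> words" "p \<in> P" "v = E p @ u" unfolding F' by blast
    note w = exchange_word_in_words[OF Pw[OF v(2)] long[OF v(2)]]
    have "p @ u \<in> words" using words_replace(1)[OF w(1) Pw[OF v(2)] w(2), of u] v by simp
    moreover have "E (p @ u) = v" using v long[of p] by (simp add: exchange_word_append)
    ultimately show "v \<in> E ` verts ?F" unfolding F using v(2) by blast
  qed
  have inj: "inj_on E (verts ?F)"
    using F_long by (intro inj_on_subset[OF exchange_word_inj]) auto
  have vb: "bij_betw E (verts ?F) (verts ?F')" using img inj by (simp add: bij_betw_def)
  have par: "parent (E e) = E (parent e)" if "e \<in> arcs ?F" for e
  proof -
    have e: "e \<in> words" "parent e \<in> words" "K \<le> length (parent e)"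
      using that F_long by (auto simp: arcs_complement_forest)
    then have "e = parent e @ [last e]" by (intro parent_eq_word) auto
    then have "E e = E (parent e) @ [last e]" using e(3) by (metis exchange_word_append)
    then show ?thesis using parent_snoc exchange_word_in_words(1)[OF e(2,3)] by metis
  qed
  have "E ` arcs ?F = arcs ?F'"
  proof (intro subset_antisym subsetI)
    fix v assume "v \<in> E ` arcs ?F"
    then obtain e where e: "v = E e" "e \<in> arcs ?F" by blast
    then have "E e \<in> verts ?F'" "E (parent e) \<in> verts ?F'"
      using img by (auto simp: arcs_complement_forest)
    moreover have "E e \<in> words" using calculation(1) unfolding F' by blast
    ultimately show "v \<in> arcs ?F'" using e par by (simp add: arcs_complement_forest)
  next
    fix v assume v: "v \<in> arcs ?F'"
    then have "v \<in> E ` verts ?F" "parent v \<in> E ` verts ?F" "v \<in> words"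
      unfolding img by (simp_all add: arcs_complement_forest)
    then obtain w w' where w: "w \<in> verts ?F" "v = E w" and w': "w' \<in> verts ?F" "parent v = E w'"
      by blast
    have Ew': "E w' \<in> words" using img w' unfolding F' by blast
    then have "E w' \<noteq> []" by auto
    with w'(2) \<open>v \<in> words\<close> have v_snoc: "v = E w' @ [last v]" by (intro parent_eq_word)
    then have "E w' @ [last v] \<in> words" using \<open>v \<in> words\<close> by simp
    moreover have "w' \<in> words" "K \<le> length w'" using F_long[OF w'(1)] by simp_all
    moreover from this have "target (E w') = target w'" by (rule exchange_word_in_words(2))
    ultimately have snoc: "w' @ [last v] \<in> words" using words_replace(1) Ew' by blast
    then have "w' @ [last v] \<in> arcs ?F"
      using w'(1) \<open>w' \<in> words\<close> by (intro forest_below_snoc_arc) (auto simp: tree_above_def)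
    moreover have "v = E (w' @ [last v])"
      using v_snoc \<open>K \<le> length w'\<close> by (simp only: exchange_word_append)
    ultimately show "v \<in> E ` arcs ?F" by blast
  qed
  moreover have "inj_on E (arcs ?F)"
    using inj by (rule inj_on_subset) (auto simp: arcs_complement_forest)
  ultimately have "bij_betw E (arcs ?F) (arcs ?F')" by (simp add: bij_betw_def)
  with vb par show ?thesis
    using complete_subtree_tree_above[OF P] complete_subtree_tree_above[OF Q]
    by (simp add: honest_iff exchange_map_def)
qed

lemma exchange_map_induces: "induces exchange_map f"
  unfolding induces_def
proof (intro exI[of _ K] conjI allI impI ballI)
  fix n x assume n: "K \<le> n" and x: "x \<in> Y"
  have "prefix n x \<frown> suffix n x \<in> Y" using x by simp
  then have "f (prefix n x \<frown> suffix n x) = E (prefix n x) \<frown> suffix n x"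
    using n by (intro exchange_word_conc(1)[OF ex]) simp_all
  then show "f x = vmap exchange_map (prefix n x) \<frown> suffix n x" by (simp add: exchange_map_def)
qed (rule NK)

lemma exchange_map_colours:
  assumes "e \<in> arcs (forest_below (dom_tree exchange_map))"
  shows "last (emap exchange_map e) = last e"
proof -
  have e: "e \<in> words" "parent e \<in> words" "K \<le> length (parent e)"
    using assms long
    by (fastforce simp: exchange_map_def arcs_complement_forest verts_complement_tree_above[OF P])+
  then have "e = parent e @ [last e]" by (intro parent_eq_word) auto
  then have "E e = E (parent e) @ [last e]" using e(3) by (metis exchange_word_append)
  then show ?thesis by (simp add: exchange_map_def)
qed

end

lemma exchange_induced_by_colour_preserving:
  assumes P: "cylinder_partition P" and long: "\<And>p. p \<in> P \<Longrightarrow> K \<le> length p"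
  shows "cylinder_partition (exchange_word K \<beta> ` P)"
    "\<exists>\<phi>\<in>induced_class f. dom_tree \<phi> = tree_above P \<and>
      cod_tree \<phi> = tree_above (exchange_word K \<beta> ` P) \<and>
      (\<forall>e\<in>arcs (forest_below (dom_tree \<phi>)). last (emap \<phi> e) = last e)"
proof -
  show "cylinder_partition (exchange_word K \<beta> ` P)" using P long by (rule cylinder_partition_exchange)
  show "\<exists>\<phi>\<in>induced_class f. dom_tree \<phi> = tree_above P \<and>
      cod_tree \<phi> = tree_above (exchange_word K \<beta> ` P) \<and>
      (\<forall>e\<in>arcs (forest_below (dom_tree \<phi>)). last (emap \<phi> e) = last e)"
    using exchange_map_honest[OF P long] exchange_map_induces[OF P long] exchange_map_colours[OF P long]
    by (intro bexI[of _ "exchange_map P"])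
      (simp_all add: induced_class_def exchange_map_def[OF P long])
qed

end

section \<open>Colour-preserving almost automorphisms induce prefix exchanges\<close>

text \<open>
  Preservation of colours means that \<open>\<phi>\<close> commutes with appending a letter. Hence it preserves the last
  vertices of words, and \<open>\<phi>(w) \<frown> z\<close> depends only on \<open>w \<frown> z\<close> for long \<open>w\<close>. Bijectivity of the
  resulting map comes from the bijectivity of \<open>\<phi>\<close> on vertices.
\<close>

lemma colour_preserving_induces_exchange:
  assumes \<phi>: "honest \<phi>" and dom: "dom_tree \<phi> \<noteq> {[]}" and cod: "cod_tree \<phi> \<noteq> {[]}"
    and colours: "\<forall>e\<in>arcs (forest_below (dom_tree \<phi>)). last (emap \<phi> e) = last e"
  obtains f K \<beta> where "f \<in> Bij Y" "exchanges_prefixes Y N f K \<beta>" "induces \<phi> f"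
proof -
  let ?F = "forest_below (dom_tree \<phi>)" and ?F' = "forest_below (cod_tree \<phi>)"
  have cD: "complete_subtree path_graph [] (dom_tree \<phi>)" and
    cC: "complete_subtree path_graph [] (cod_tree \<phi>)" and
    vb: "bij_betw (vmap \<phi>) (verts ?F) (verts ?F')"
    using \<phi> by (simp_all add: honest_iff)
  have no_root: "verts (forest_below S) \<subseteq> words"
    if S: "complete_subtree path_graph [] S" "S \<noteq> {[]}" for S
    using complete_subtree_root_leaf[OF S(1)] S(2)
    by (auto simp: verts_complement_forest[OF complete_subtree_verts[OF S(1)]])
  have Fw: "verts ?F \<subseteq> words" and Fw': "verts ?F' \<subseteq> words"
    using no_root[OF cD dom] no_root[OF cC cod] .
  have img: "vmap \<phi> w \<in> words" if "w \<in> verts ?F" for w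
    using vb that Fw' by (auto simp: bij_betw_def)
  have vmap_snoc: "vmap \<phi> (w @ [e]) = vmap \<phi> w @ [e]"
    if w: "w \<in> verts ?F" and we: "w @ [e] \<in> words" for w e
  proof -
    have ww: "w \<in> words" using w Fw by blast
    note s = honest_vmap_snoc[OF \<phi> w ww we]
    have "w @ [e] \<in> arcs ?F"
      using forest_below_snoc_arc[OF complete_subtree_verts[OF cD] w ww we] .
    then have "last (vmap \<phi> (w @ [e])) = e" using colours s(3) by (metis last_snoc)
    moreover have "vmap \<phi> (w @ [e]) = vmap \<phi> w @ [last (vmap \<phi> (w @ [e]))]"
      using img[OF w] s by (intro parent_eq_word) auto
    ultimately show ?thesis by simp
  qed
  have append: "w @ u \<in> words \<Longrightarrow> vmap \<phi> (w @ u) = vmap \<phi> w @ u" if w: "w \<in> verts ?F" for w u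
  proof (induction u rule: rev_induct)
    case (snoc e u)
    have ww: "w \<in> words" using w Fw by blast
    have wu: "w @ u \<in> words"
      using words_take[of "w @ u" "[e]"] snoc.prems words_length[OF ww] by simp
    have "w @ u \<in> verts ?F"
      using forest_below_extend[OF complete_subtree_verts[OF cD] w wu] .
    from vmap_snoc[OF this, of e]
    show ?case using snoc.IH[OF wu] snoc.prems by simp
  qed simp
  have target: "target (vmap \<phi> w) = target w" if w: "w \<in> verts ?F" for w
  proof -
    have ww: "w \<in> words" using w Fw by blast
    obtain e where e: "e \<in> arcs G" "tail G e = target w"
      using out_arc_exists[OF target_in_verts[OF ww]] by blast
    then have we: "w @ [e] \<in> words" using snoc_in_words_iff[OF ww] by blast
    then have "vmap \<phi> w @ [e] \<in> words"
      using honest_vmap_snoc(1)[OF \<phi> w ww we] vmap_snoc[OF w we] by simp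
    then show ?thesis using snoc_in_words_iff[OF img[OF w]] e by simp
  qed
  obtain K where K: "N \<le> K" "\<And>w. w \<in> words \<Longrightarrow> K \<le> length w \<Longrightarrow> w \<in> verts ?F"
    using cD by (rule complete_subtree_deep) blast
  have deep: "prefix n x \<in> verts ?F" if "x \<in> Y" "K \<le> n" for n x
    using K prefix_in_words[OF that(1), of n] that(2) by simp
  define f where "f = (\<lambda>x\<in>Y. vmap \<phi> (prefix K x) \<frown> suffix K x)"
  have f_eq: "f x = vmap \<phi> (prefix n x) \<frown> suffix n x" if x: "x \<in> Y" and n: "K \<le> n" for n x
  proof -
    obtain j where j: "n = K + j" using n le_Suc_ex by blast
    have pn: "prefix n x = prefix K x @ prefix j (suffix K x)" unfolding j by (rule prefix_add)
    have "vmap \<phi> (prefix n x) = vmap \<phi> (prefix K x) @ prefix j (suffix K x)"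
      unfolding pn using append[OF deep[OF x order_refl]] prefix_in_words[OF x, of n] K(1) n pn by simp
    moreover have "suffix K x = prefix j (suffix K x) \<frown> suffix n x"
      using prefix_suffix[of "suffix K x" j] by (simp add: j)
    ultimately show ?thesis using x by (simp add: f_def)
  qed
  have fY: "f x \<in> Y" if x: "x \<in> Y" for x
    using conc_in_Y[OF img[OF deep[OF x order_refl]], of "suffix K x"] suffix_start[OF x K(1)]
      target[OF deep[OF x order_refl]] x by (simp add: f_def)
  have wlog: "x = y"
    if x: "x \<in> Y" and y: "y \<in> Y" and eq: "f x = f y"
      and le: "length (vmap \<phi> (prefix K x)) \<le> length (vmap \<phi> (prefix K y))" for x y
  proof -
    have "vmap \<phi> (prefix K x) \<frown> suffix K x = vmap \<phi> (prefix K y) \<frown> suffix K y"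
      using eq x y by (simp add: f_def)
    then obtain t where t: "vmap \<phi> (prefix K y) = vmap \<phi> (prefix K x) @ t" "suffix K x = t \<frown> suffix K y"
      using le by (rule conc_eq_cases)
    have pt: "prefix (K + length t) x = prefix K x @ t"
      using prefix_add[of x K "length t"] t(2) by simp
    then have "prefix K x @ t \<in> words" using prefix_in_words[OF x, of "K + length t"] K(1) by simp
    then have "vmap \<phi> (prefix K x @ t) = vmap \<phi> (prefix K y)"
      using append[OF deep[OF x order_refl]] t(1) by simp
    moreover have "prefix K x @ t \<in> verts ?F" using deep[OF x, of "K + length t"] pt by simp
    ultimately have eqp: "prefix K x @ t = prefix K y"
      using vb deep[OF y order_refl] by (auto simp: bij_betw_def inj_on_def)
    then have "length (prefix K x @ t) = length (prefix K y)" by (simp only:)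
    then have "t = []" by simp
    then show ?thesis using eqp t(2) prefix_suffix[of x K] prefix_suffix[of y K] by simp
  qed
  have inj: "inj_on f Y"
    using wlog by (intro inj_onI) (metis nat_le_linear)
  have surj: "Y \<subseteq> f ` Y"
  proof
    fix y assume y: "y \<in> Y"
    obtain K' where K': "N \<le> K'" "\<And>w. w \<in> words \<Longrightarrow> K' \<le> length w \<Longrightarrow> w \<in> verts ?F'"
      using cC by (rule complete_subtree_deep) blast
    \<comment> \<open>a prefix of \<open>y\<close> longer than the images of all short words is the image of a long word\<close>
    let ?L = "(\<lambda>w. length (vmap \<phi> w)) ` {w \<in> words. length w \<le> K}"
    define n where "n = K' + Suc (Max ?L)"
    have "prefix n y \<in> verts ?F'" using K' prefix_in_words[OF y, of n] by (simp add: n_def)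
    then have "prefix n y \<in> vmap \<phi> ` verts ?F" using vb by (simp add: bij_betw_def)
    then obtain w where w: "w \<in> verts ?F" "vmap \<phi> w = prefix n y" by auto
    have ww: "w \<in> words" using w Fw by blast
    have "K < length w"
    proof (rule ccontr)
      assume "\<not> K < length w"
      then have "length (vmap \<phi> w) \<le> Max ?L"
        using ww words_of_length_finite[of K] by (intro Max_ge) auto
      then show False unfolding w(2) by (simp add: n_def)
    qed
    have "tail G (suffix n y 0) = target w"
      using suffix_start[OF y, of n] target[OF w(1)] w(2) K'(1) by (simp add: n_def)
    then have x: "w \<frown> suffix n y \<in> Y"
      using suffix_start[OF y, of n] K'(1) by (intro conc_in_Y[OF ww]) (auto simp: n_def)
    have "f (w \<frown> suffix n y) = vmap \<phi> w \<frown> suffix n y"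
      using f_eq[OF x, of "length w"] \<open>K < length w\<close> by simp
    also have "\<dots> = y" unfolding w(2) by simp
    finally show "y \<in> f ` Y" using x by (intro image_eqI) simp_all
  qed
  have "f ` Y = Y" using surj fY by blast
  then have "f \<in> Bij Y" using inj by (simp add: Bij_def bij_betw_def f_def)
  moreover have "exchanges_prefixes Y N f K (vmap \<phi>)"
    unfolding exchanges_prefixes_def
    using words_length img deep by (auto simp: f_def)
  moreover have "induces \<phi> f"
    unfolding induces_def using f_eq K(1) by blast
  ultimately show ?thesis using that by blast
qed

section \<open>The isomorphism\<close>

abbreviation full_group :: "((nat \<Rightarrow> 'e) \<Rightarrow> nat \<Rightarrow> 'e) monoid" where
  "full_group \<equiv> topological_full_group Y_groupoid"

abbreviation colour_group :: "('e list, 'e list) tree_map set monoid" where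
  "colour_group \<equiv> colour_preserving_group path_graph [] path_colouring"

lemma full_group_Bij: "f \<in> carrier full_group \<Longrightarrow> f \<in> Bij Y"
  by (simp add: carrier_full_group_iff)

lemma full_group_mult:
  "f \<in> carrier full_group \<Longrightarrow> g \<in> carrier full_group \<Longrightarrow> f \<otimes>\<^bsub>full_group\<^esub> g = compose Y f g"
  using full_group_Bij[of f] full_group_Bij[of g]
  by (simp add: topological_full_group_def homeo_group_def BijGroup_def gobj_Y_groupoid topspace_Y_top
      del: topspace_subtopology)

text \<open>
  Every sufficiently fine cylinder partition is the leaf set of the domain of a representative, and
  the leaves of the codomain of a representative can be made arbitrarily long. Together these provide
  composable representatives.
\<close>

lemma full_group_induced:
  assumes "f \<in> carrier full_group"
  obtains K where "N \<le> K"
    "\<And>P. cylinder_partition P \<Longrightarrow> (\<And>p. p \<in> P \<Longrightarrow> K \<le> length p) \<Longrightarrow>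
      \<exists>\<phi>\<in>induced_class f. dom_tree \<phi> = tree_above P \<and> cod_tree \<phi> \<noteq> {[]} \<and>
        (\<forall>e\<in>arcs (forest_below (dom_tree \<phi>)). last (emap \<phi> e) = last e)"
    "\<And>j. \<exists>\<phi>\<in>induced_class f. \<exists>Q. cylinder_partition Q \<and> cod_tree \<phi> = tree_above Q \<and>
        (\<forall>q\<in>Q. j \<le> length q)"
proof -
  obtain K \<beta> where K: "N \<le> K" and ex: "exchanges_prefixes Y N f K \<beta>"
    using full_group_exchanges_prefixes[OF assms] by blast
  note fB = full_group_Bij[OF assms]
  show ?thesis
  proof (rule that[of K])
    show "\<exists>\<phi>\<in>induced_class f. dom_tree \<phi> = tree_above P \<and> cod_tree \<phi> \<noteq> {[]} \<and>
        (\<forall>e\<in>arcs (forest_below (dom_tree \<phi>)). last (emap \<phi> e) = last e)"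
      if P: "cylinder_partition P" "\<And>p. p \<in> P \<Longrightarrow> K \<le> length p" for P
      using exchange_induced_by_colour_preserving[OF fB K ex P] tree_above_not_root by metis
    show "\<exists>\<phi>\<in>induced_class f. \<exists>Q. cylinder_partition Q \<and> cod_tree \<phi> = tree_above Q \<and>
        (\<forall>q\<in>Q. j \<le> length q)" for j
    proof -
      let ?P = "{w \<in> words. length w = K + j}"
      have P: "cylinder_partition ?P" using K by (intro cylinder_partition_of_length) simp
      have "K \<le> length p" if "p \<in> ?P" for p using that by simp
      note real = exchange_induced_by_colour_preserving[OF fB K ex P this]
      from real(2) obtain \<phi> where "\<phi> \<in> induced_class f"
          "cod_tree \<phi> = tree_above (exchange_word K \<beta> ` ?P)"
        by blast
      moreover have "\<forall>q\<in>exchange_word K \<beta> ` ?P. j \<le> length q" by (auto simp: exchange_word_def)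
      ultimately show ?thesis using real(1) by blast
    qed
  qed (rule K)
qed

lemma induced_class_in_colour_group:
  assumes "f \<in> carrier full_group"
  shows "induced_class f \<in> carrier colour_group"
proof -
  obtain K where K: "N \<le> K"
    and real: "\<And>P. cylinder_partition P \<Longrightarrow> (\<And>p. p \<in> P \<Longrightarrow> K \<le> length p) \<Longrightarrow>
      \<exists>\<phi>\<in>induced_class f. dom_tree \<phi> = tree_above P \<and> cod_tree \<phi> \<noteq> {[]} \<and>
        (\<forall>e\<in>arcs (forest_below (dom_tree \<phi>)). last (emap \<phi> e) = last e)"
    using assms by (rule full_group_induced) blast
  let ?P = "{w \<in> words. length w = K}"
  have P: "cylinder_partition ?P" using K by (rule cylinder_partition_of_length)
  have "K \<le> length p" if "p \<in> ?P" for p using that by simp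
  from real[OF P this] obtain \<phi> where \<phi>: "\<phi> \<in> induced_class f" "dom_tree \<phi> = tree_above ?P"
      "cod_tree \<phi> \<noteq> {[]}" "\<forall>e\<in>arcs (forest_below (dom_tree \<phi>)). last (emap \<phi> e) = last e"
    by blast
  have "dom_tree \<phi> \<noteq> {[]}" using tree_above_not_root[OF P] \<phi>(2) by simp
  moreover have "induced_class f \<in> carrier (AAut path_graph [])"
    using induced_class_eq[OF \<phi>(1)] \<phi>(1)
    by (auto simp: AAut_def quotient_def induced_class_def)
  moreover have "ccol path_colouring = last" by (simp add: path_colouring_def)
  ultimately show ?thesis
    using \<phi>(1,3,4) unfolding colour_preserving_group_def by force
qed

text \<open>
  Every composite of composable representatives induces \<open>f \<circ> g\<close>, so all the classes united in the
  product of the two classes coincide, and it remains to see that there is at least one.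
\<close>

lemma induced_class_mult:
  assumes f: "f \<in> carrier full_group" and g: "g \<in> carrier full_group"
  shows "induced_class (f \<otimes>\<^bsub>full_group\<^esub> g) = induced_class f \<otimes>\<^bsub>colour_group\<^esub> induced_class g"
proof -
  let ?h = "compose Y f g"
  have gY: "g x \<in> Y" if "x \<in> Y" for x
    using full_group_Bij[OF g] that by (auto simp: Bij_def bij_betw_def)
  have comp: "tree_map_comp \<phi> \<psi> \<in> induced_class ?h"
    if "\<phi> \<in> induced_class f" "\<psi> \<in> induced_class g" "cod_tree \<psi> = dom_tree \<phi>" for \<phi> \<psi>
    using that honest_comp[of \<phi> \<psi>] induces_comp[of \<phi> f \<psi> g ?h] gY
    by (simp add: induced_class_def compose_def)
  obtain K where real: "\<And>P. cylinder_partition P \<Longrightarrow> (\<And>p. p \<in> P \<Longrightarrow> K \<le> length p) \<Longrightarrow>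
      \<exists>\<phi>\<in>induced_class f. dom_tree \<phi> = tree_above P \<and> cod_tree \<phi> \<noteq> {[]} \<and>
        (\<forall>e\<in>arcs (forest_below (dom_tree \<phi>)). last (emap \<phi> e) = last e)"
    using f by (rule full_group_induced) blast
  obtain \<psi> Q where \<psi>: "\<psi> \<in> induced_class g" "cylinder_partition Q" "cod_tree \<psi> = tree_above Q"
      "\<forall>q\<in>Q. K \<le> length q"
    using g by (rule full_group_induced) blast
  obtain \<phi> where \<phi>: "\<phi> \<in> induced_class f" "dom_tree \<phi> = tree_above Q"
    using real[OF \<psi>(2)] \<psi>(4) by blast
  let ?A = "{almost_equal path_graph [] `` {tree_map_comp \<phi> \<psi>} | \<phi> \<psi>.
      \<phi> \<in> induced_class f \<and> \<psi> \<in> induced_class g \<and> cod_tree \<psi> = dom_tree \<phi>}"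
  have "A = induced_class ?h" if "A \<in> ?A" for A
    using that comp induced_class_eq by blast
  moreover have "almost_equal path_graph [] `` {tree_map_comp \<phi> \<psi>} \<in> ?A"
    using \<phi> \<psi> by (intro CollectI exI[of _ \<phi>] exI[of _ \<psi>]) auto
  ultimately have "?A = {induced_class ?h}" by blast
  then have "\<Union>?A = induced_class ?h" by (simp only: Union_insert Union_empty Un_empty_right)
  then show ?thesis
    using full_group_mult[OF f g] by (simp add: colour_preserving_group_def AAut_def)
qed

lemma induced_class_inj: "inj_on induced_class (carrier full_group)"
proof (rule inj_onI)
  fix f g assume f: "f \<in> carrier full_group" and g: "g \<in> carrier full_group"
    and eq: "induced_class f = induced_class g"
  obtain \<phi> where "\<phi> \<in> induced_class f" using f by (rule full_group_induced) blast
  then have "induces \<phi> f" "induces \<phi> g" using eq by (auto simp: induced_class_def)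
  then obtain K1 K2 where
    "\<And>n x. K1 \<le> n \<Longrightarrow> x \<in> Y \<Longrightarrow> f x = vmap \<phi> (prefix n x) \<frown> suffix n x"
    "\<And>n x. K2 \<le> n \<Longrightarrow> x \<in> Y \<Longrightarrow> g x = vmap \<phi> (prefix n x) \<frown> suffix n x"
    unfolding induces_def by metis
  from this[of "K1 + K2"] have "f x = g x" if "x \<in> Y" for x using that by simp
  then show "f = g"
    using full_group_Bij[OF f] full_group_Bij[OF g]
    by (intro extensionalityI[of f Y g]) (auto simp: Bij_def)
qed

lemma induced_class_surj: "carrier colour_group \<subseteq> induced_class ` carrier full_group"
proof
  fix A assume "A \<in> carrier colour_group"
  then obtain \<phi> where A: "A \<in> {\<phi>. honest \<phi>} // almost_equal path_graph []" and \<phi>: "\<phi> \<in> A"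
      "dom_tree \<phi> \<noteq> {[]}" "cod_tree \<phi> \<noteq> {[]}"
      "\<forall>e\<in>arcs (forest_below (dom_tree \<phi>)). last (emap \<phi> e) = last e"
    by (auto simp: colour_preserving_group_def AAut_def path_colouring_def)
  from A obtain \<phi>' where \<phi>': "A = almost_equal path_graph [] `` {\<phi>'}"
    by (auto simp: quotient_def)
  then have ae: "(\<phi>, \<phi>') \<in> almost_equal path_graph []" using \<phi>(1) by (auto intro: almost_equal_sym)
  then have hon: "honest \<phi>" by (simp add: almost_equal_def)
  then obtain f K \<beta> where f: "f \<in> Bij Y" "exchanges_prefixes Y N f K \<beta>" "induces \<phi> f"
    using \<phi>(2-4) by (rule colour_preserving_induces_exchange)
  have "\<phi>' \<in> induced_class f"
    using induces_almost_equal[OF ae f(3)] by (simp add: induced_class_def)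
  then have "A = induced_class f" using induced_class_eq \<phi>' by simp
  moreover have "f \<in> carrier full_group" using f by (intro exchanges_prefixes_full_group)
  ultimately show "A \<in> induced_class ` carrier full_group" by blast
qed

theorem full_group_iso_colour_group: "full_group \<cong> colour_group"
proof -
  have "induced_class \<in> iso full_group colour_group"
    using induced_class_in_colour_group induced_class_mult induced_class_inj induced_class_surj
    by (auto simp: iso_def hom_def bij_betw_def)
  then show ?thesis by (auto simp: is_iso_def)
qed

end

section \<open>Choice of the window length\<close>

lemma exists_window:
  assumes "clopen_subshift G Y"
  shows "\<exists>n. \<forall>x\<in>Y. \<forall>y\<in>shift_space G. prefix n y = prefix n x \<longrightarrow> y \<in> Y"
proof -
  interpret clopen_subshift G Y by fact
  let ?Q = "\<lambda>w. \<forall>y\<in>shift_space G. prefix (length w) y = w \<longrightarrow> y \<in> Y"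
  have "\<exists>n. ?Q (prefix n x)" if "x \<in> Y" for x
    using openin_shift_topologyD[of G Y x] clopen that by (simp add: clopenin_def)
  moreover have "?Q (w @ u)" if "?Q w" for w u
  proof (intro ballI impI)
    fix y assume y: "y \<in> shift_space G" "prefix (length (w @ u)) y = w @ u"
    then have "prefix (length w) y @ prefix (length u) (suffix (length w) y) = w @ u"
      by (simp only: length_append prefix_add)
    then have "prefix (length w) y = w" by simp
    then show "y \<in> Y" using that y(1) by blast
  qed
  ultimately obtain n where "\<And>x m. x \<in> Y \<Longrightarrow> n \<le> m \<Longrightarrow> ?Q (prefix m x)"
    using uniform_prefix_length[of Y ?Q] clopen unfolding clopenin_def by blast
  then have "?Q (prefix n x)" if "x \<in> Y" for x using that by blast
  then show ?thesis by (intro exI[of _ n]) simp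
qed

text \<open>
  Two different paths from the vertex reached by a prefix of a point of \<open>Y\<close> give two points of \<open>Y\<close>;
  \<open>N\<close> is taken beyond a position where they differ.
\<close>

lemma exists_path_tree:
  assumes "branching_graph G" and "clopen_subshift G Y" and "Y \<noteq> {}"
  shows "\<exists>N. path_tree G Y N"
proof -
  interpret branching_graph G by fact
  interpret clopen_subshift G Y by fact
  obtain n where n: "\<And>x y. x \<in> Y \<Longrightarrow> y \<in> shift_space G \<Longrightarrow> prefix n y = prefix n x \<Longrightarrow> y \<in> Y"
    using exists_window[OF assms(2)] by blast
  obtain x where x: "x \<in> Y" using assms(3) by blast
  then have xX: "x \<in> shift_space G" using Y_subset by blast
  obtain z z' where z: "z \<in> shift_space G" "z' \<in> shift_space G" "z \<noteq> z'"
      "tail G (z 0) = head G (x n)" "tail G (z' 0) = head G (x n)"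
    using two_paths_from_vertex[of "head G (x n)"] xX by (auto simp: shift_space_def)
  have Y: "prefix (Suc n) x \<frown> z \<in> Y" if "z \<in> shift_space G" "tail G (z 0) = head G (x n)" for z
  proof -
    have "prefix (Suc n) x \<frown> z \<in> shift_space G"
      using xX that by (intro prefix_conc_in_shift_space) auto
    moreover have "prefix n (prefix (Suc n) x \<frown> z) = prefix n x" by (simp add: prefix_eq_iff)
    ultimately show ?thesis using n[OF x] by blast
  qed
  obtain i where i: "z i \<noteq> z' i" using z(3) by (auto simp: fun_eq_iff)
  let ?N = "Suc (Suc n + i)"
  have "prefix ?N (prefix (Suc n) x \<frown> z) \<noteq> prefix ?N (prefix (Suc n) x \<frown> z')"
  proof
    assume "prefix ?N (prefix (Suc n) x \<frown> z) = prefix ?N (prefix (Suc n) x \<frown> z')"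
    then have "(prefix (Suc n) x \<frown> z) (Suc n + i) = (prefix (Suc n) x \<frown> z') (Suc n + i)"
      unfolding prefix_eq_iff by blast
    then show False using i by (simp add: conc_def)
  qed
  moreover have "y \<in> Y" if "w \<in> Y" "y \<in> shift_space G" "prefix ?N y = prefix ?N w" for w y
    using n[OF that(1,2) prefix_le_eq[OF that(3)]] by simp
  ultimately have "path_tree G Y ?N"
    using Y z by unfold_locales blast+
  then show ?thesis ..
qed

theorem theorem3p8:
  fixes G :: "('v, 'e) pre_digraph" and Y :: "(nat \<Rightarrow> 'e) set"
  assumes "fin_digraph G"
    and "diconnected G"
    and "non_circular G"
    and "clopenin (shift_topology G) Y"
    and "Y \<noteq> {}"
  shows "\<exists>(T :: ('e list, 'e list) pre_digraph) v\<^sub>0 (C :: ('e list, 'e list, 'v, 'e) colouring).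
    rooted_tree T v\<^sub>0 \<and> locally_finite_graph T \<and> colouring_structure T v\<^sub>0 C \<and>
    topological_full_group (groupoid_restrict (shift_groupoid G) Y)
      \<cong> colour_preserving_group T v\<^sub>0 C"
proof -
  have "branching_graph G"
    using assms by (intro branching_graph.intro branching_graph_axioms.intro)
  moreover have "clopen_subshift G Y"
    using assms by (intro clopen_subshift.intro clopen_subshift_axioms.intro)
  ultimately obtain N where "path_tree G Y N" using exists_path_tree assms(5) by blast
  then interpret path_tree G Y N .
  show ?thesis
    using rooted_tree_path_graph locally_finite_path_graph colouring_structure_path_graph
      full_group_iso_colour_group by blast
qed

end
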